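(* Let $\mathbb{I}=\{\mathbb{I}_1,\dots,\mathbb{I}_N\}$ be a random iterated function system of Bedford--McMullen type, with grid parameters $n_i>m_i\geq2$, number of non-empty columns $A_i$ and maximal number of rectangles in a column $B_i$ for each $i\in\Lambda$. Then for $\mu$-almost all $\omega\in\Omega$ $$\dim_{\mathrm A}F_\omega\ =\ \max_{i\in\Lambda}\frac{\log A_i}{\log m_i}\,+\,\max_{i\in\Lambda}\frac{\log B_i}{\log n_i}.$$
   Context: Assouad dimension: for a non-empty bounded set $F\subseteq\mathbb{R}^2$ let $N_r(F)$ be the smallest number of sets of diameter at most $r$ needed to cover $F$. Then $\dim_{\mathrm A}F$ is the infimum of all $\alpha \geq 0$ for which there exist $C,\rho>0$ such that for all $0<r<R\leq\rho$, $\sup_{x\in F}N_r(B(x,R)\cap F)\leq C(R/r)^\alpha$. Let $\Lambda=\{1,\dots,N\}$ and $\Omega=\Lambda^{\mathbb{N}}$ (product topology). Bedford--McMullen type RIFS: for each $i\in\Lambda$ fix integers $n_i>m_i\geq2$, divide $[0,1]^2$ into a uniform $m_i\times n_i$ grid ($m_i$ columns of width $1/m_i$, $n_i$ rows of height $1/n_i$) and select a non-empty subset of the sub-rectangles. $\mathbb{I}_i=\{S_{i,j}\}_{j\in\mathcal{I}_i}$ consists of the maps (one for each selected rectangle, so distinct) $S_{i,j}:[0,1]^2\to[0,1]^2$, $$S_{i,j}(x,y)=\Big(\frac{x}{m_i}+\frac{a_{i,j}}{m_i},\ \frac{y}{n_i}+\frac{b_{i,j}}{n_i}\Big),$$ with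 integers $0\leq a_{i,j}<m_i$, $0\leq b_{i,j}<n_i$. $A_i$ is the number of distinct integers $a_{i,j}$, $j\in\mathcal{I}_i$; $B_i=\max_{k\in\{0,\dots,m_i-1\}}|\{j\in\mathcal{I}_i:a_{i,j}=k\}|$. For $\omega=(\omega_1,\omega_2,\dots)\in\Omega$, $$F_\omega=\bigcap_{k\geq1}\ \bigcup_{i_1\in\mathcal{I}_{\omega_1},\dots,i_k\in\mathcal{I}_{\omega_k}}S_{\omega_1,i_1}\circ\cdots\circ S_{\omega_k,i_k}([0,1]^2).$$ Measure: $(p_1,\dots,p_N)$ is a fixed probability vector with all $p_i>0$, and $\mu$ is the Bernoulli (product) Borel probability measure on $\Omega$ giving the cylinder $\{\omega:\omega_1=w_1,\dots,\omega_k=w_k\}$ mass $p_{w_1}p_{w_2}\cdots p_{w_k}$. *)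

theory Defs
  imports "HOL-Probability.Probability"
begin

text \<open>
  Library \<open>diameter\<close> is only meaningful on bounded sets, hence the explicit boundedness
  requirement.
\<close>
definition covering_number :: "real \<Rightarrow> (real \<times> real) set \<Rightarrow> nat" where
  "covering_number r F =
     (LEAST k. \<exists>\<U>. finite \<U> \<and> card \<U> = k \<and> (\<forall>U\<in>\<U>. bounded U \<and> diameter U \<le> r) \<and> F \<subseteq> \<Union>\<U>)"

text \<open>
  The type \<open>real \<times> real\<close> carries the Euclidean metric. The bound on the supremum over
  \<open>x \<in> F\<close> is written pointwise. Every subset of the plane is doubling, so the infimum is taken
  over a non-empty set (every \<open>\<alpha> \<ge> 2\<close> is admissible).
\<close>
definition assouad_dim :: "(real \<times> real) set \<Rightarrow> real" where
  "assouad_dim F = Inf {\<alpha>. 0 \<le> \<alpha> \<and>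
     (\<exists>C>0. \<exists>\<rho>>0. \<forall>r R. 0 < r \<and> r < R \<and> R \<le> \<rho> \<longrightarrow>
        (\<forall>x\<in>F. real (covering_number r (cball x R \<inter> F)) \<le> C * (R / r) powr \<alpha>))}"

text \<open>
  Bedford--McMullen type RIFS. The \<open>i\<close>-th IFS is given by the grid sizes \<open>m i\<close> (columns) and
  \<open>n i\<close> (rows) and the set \<open>D i\<close> of selected rectangles; the rectangle in column \<open>a\<close> and row \<open>b\<close>
  is represented by the pair \<open>(a, b)\<close>, so that \<open>D i\<close> itself serves as the index set of the maps.
\<close>
definition bm_map :: "nat \<Rightarrow> nat \<Rightarrow> nat \<times> nat \<Rightarrow> real \<times> real \<Rightarrow> real \<times> real" where
  "bm_map m n d = (\<lambda>(x, y). (x / real m + real (fst d) / real m, y / real n + real (snd d) / real n))"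

definition num_columns :: "(nat \<times> nat) set \<Rightarrow> nat" where
  "num_columns D = card (fst ` D)"

definition max_in_column :: "nat \<Rightarrow> (nat \<times> nat) set \<Rightarrow> nat" where
  "max_in_column m D = (MAX k\<in>{0..<m}. card {d \<in> D. fst d = k})"

text \<open>
  Sequences are indexed from \<open>0\<close>: \<open>\<omega> l\<close> and \<open>d l\<close> stand for the \<open>(l+1)\<close>-st entries, so
  \<open>bm_comp m n \<omega> d k\<close> is the composition of the maps number \<open>1, \<dots>, k\<close>, the first one outermost.
\<close>
primrec bm_comp ::
  "(nat \<Rightarrow> nat) \<Rightarrow> (nat \<Rightarrow> nat) \<Rightarrow> (nat \<Rightarrow> nat) \<Rightarrow> (nat \<Rightarrow> nat \<times> nat) \<Rightarrow> nat \<Rightarrow> real \<times> real \<Rightarrow> real \<times> real"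
where
  "bm_comp m n \<omega> d 0 = id"
| "bm_comp m n \<omega> d (Suc k) = bm_comp m n \<omega> d k \<circ> bm_map (m (\<omega> k)) (n (\<omega> k)) (d k)"

definition bm_attractor ::
  "(nat \<Rightarrow> nat) \<Rightarrow> (nat \<Rightarrow> nat) \<Rightarrow> (nat \<Rightarrow> (nat \<times> nat) set) \<Rightarrow> (nat \<Rightarrow> nat) \<Rightarrow> (real \<times> real) set"
where
  "bm_attractor m n D \<omega> =
     (\<Inter>k\<in>{1..}. \<Union>d\<in>{d. \<forall>l<k. d l \<in> D (\<omega> l)}. bm_comp m n \<omega> d k ` ({0..1} \<times> {0..1}))"

text \<open>
  The space of this measure is the set of all sequences in \<open>{1..N}\<close>, and its sigma-algebra is
  generated by the cylinders, i.e. it is the Borel sigma-algebra of the product topology.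
\<close>
definition bernoulli_measure :: "nat \<Rightarrow> (nat \<Rightarrow> real) \<Rightarrow> (nat \<Rightarrow> nat) measure" where
  "bernoulli_measure N p = PiM UNIV (\<lambda>_. point_measure {1..N} (\<lambda>i. ennreal (p i)))"

lemma space_bernoulli_measure: "space (bernoulli_measure N p) = {\<omega>. \<forall>l. \<omega> l \<in> {1..N}}"
  by (auto simp: bernoulli_measure_def space_PiM space_point_measure PiE_def Pi_def)

lemma emeasure_bernoulli_measure_cylinder:
  assumes "\<And>i. i \<in> {1..N} \<Longrightarrow> 0 < p i" "sum p {1..N} = 1" "\<And>l. l < k \<Longrightarrow> w l \<in> {1..N}"
  shows "emeasure (bernoulli_measure N p) {\<omega> \<in> space (bernoulli_measure N p). \<forall>l<k. \<omega> l = w l}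
           = ennreal (\<Prod>l<k. p (w l))"
proof -
  let ?P = "point_measure {1..N} (\<lambda>i. ennreal (p i))"
  have "(\<Sum>i\<in>{1..N}. ennreal (p i)) = ennreal (sum p {1..N})"
    using assms(1) by (intro sum_ennreal) (auto simp: less_imp_le)
  then have "prob_space ?P"
    using assms(2) by (intro prob_space_point_measure) auto
  then interpret product_prob_space "\<lambda>_. ?P" "UNIV :: nat set"
    by (simp add: product_prob_space_def product_sigma_finite_def
        product_prob_space_axioms_def prob_space_imp_sigma_finite)
  have "emeasure (PiM UNIV (\<lambda>_. ?P)) {\<omega> \<in> space (PiM UNIV (\<lambda>_. ?P)). \<forall>l\<in>{..<k}. \<omega> l \<in> {w l}}
      = (\<Prod>l<k. emeasure ?P {w l})"
    using assms(3) by (intro emeasure_PiM_Collect) (auto simp: sets_point_measure)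
  also have "\<dots> = (\<Prod>l<k. ennreal (p (w l)))"
    using assms(3) by (intro prod.cong) (auto simp: emeasure_point_measure_finite)
  also have "\<dots> = ennreal (\<Prod>l<k. p (w l))"
    using assms(1,3) by (intro prod_ennreal) (auto simp: less_imp_le)
  finally show ?thesis
    by (simp add: bernoulli_measure_def lessThan_iff Ball_def)
qed

end

theory Submission
  imports Defs
begin

text \<open>
  Write \<open>\<alpha>\<close> and \<open>\<beta>\<close> for the two maxima. At a given scale the attractor is seen through approximate squares: a
  column of the level at which cylinders have that width, crossed with a row of the smaller level at which
  they have that height. Each such square is described by two digit strings of different lengths.
  
  Upper bound, for every letter sequence. When the scale is refined from \<open>R\<close> to \<open>r\<close>, the column string is extended over the
  levels whose widths lie between \<open>r\<close> and \<open>R\<close>, and the row string over the levels whose heights do. Extending the columns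
  first leaves, at each of the row levels, at most \<open>max_in_column \<le> n powr \<beta>\<close> choices, while each column level offered
  \<open>num_columns \<le> m powr \<alpha>\<close>. The products of the \<open>m\<close> and of the \<open>n\<close> over these levels are both comparable to \<open>R / r\<close>,
  which gives a covering number of order \<open>(R / r) powr (\<alpha> + \<beta>)\<close>; see \<open>covering_number_attractor_le\<close>.
  
  Lower bound, almost surely. The row levels and the column levels that belong to the same scales are far apart in the
  letter sequence, so nothing prevents the first from carrying only a letter \<open>j\<close> that is optimal for \<open>\<beta>\<close> and the second only
  a letter \<open>i\<close> that is optimal for \<open>\<alpha>\<close>. If blocks of this kind occur, then both estimates above are attained
  up to constants (\<open>covering_number_attractor_ge\<close>), and arbitrarily long blocks at arbitrarily small scales exclude every
  exponent below \<open>\<alpha> + \<beta>\<close> (\<open>admissible_exponent_ge\<close>).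
  
  Such blocks occur by a Borel--Cantelli argument. The level \<open>k\<close> of the first block is free, but the level at which the
  second block must start depends on the letters: it is the first level whose width is at most the height of level \<open>k\<close>. This is a stopping
  time that is bounded in terms of \<open>k\<close>, so for given block lengths the pair of blocks has the same conditional probability for every
  large \<open>k\<close>, and attempts at sufficiently sparse positions are independent (\<open>AE_two_blocks\<close>).
\<close>

section \<open>Mixed radix expansions\<close>

definition radix_prod :: "(nat \<Rightarrow> nat) \<Rightarrow> nat \<Rightarrow> real" where
  "radix_prod c k = (\<Prod>l<k. real (c l))"

text \<open>
  For a sequence \<open>c\<close> of bases, the digits \<open>a 0, \<dots>, a (k - 1)\<close> name one of the \<open>c 0 * \<dots> * c (k - 1)\<close>
  subintervals of equal length of the unit interval. The index of that subinterval, counted from the left,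
  is the mixed radix numeral formed by the digits.
\<close>
primrec cell_index :: "(nat \<Rightarrow> nat) \<Rightarrow> (nat \<Rightarrow> nat) \<Rightarrow> nat \<Rightarrow> nat" where
  "cell_index c a 0 = 0"
| "cell_index c a (Suc k) = c k * cell_index c a k + a k"

text \<open>
  The left end points of the nested cells increase, so their supremum is the point
  \<open>\<Sum>l. a l / (c 0 * \<dots> * c l)\<close> with the given digits.
\<close>
definition radix_value :: "(nat \<Rightarrow> nat) \<Rightarrow> (nat \<Rightarrow> nat) \<Rightarrow> real" where
  "radix_value c a = (SUP k. real (cell_index c a k) / radix_prod c k)"

definition radix_cell :: "(nat \<Rightarrow> nat) \<Rightarrow> (nat \<Rightarrow> nat) \<Rightarrow> nat \<Rightarrow> real set" where
  "radix_cell c a k = {real (cell_index c a k) / radix_prod c k .. (real (cell_index c a k) + 1) / radix_prod c k}"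

lemma radix_prod_0 [simp]: "radix_prod c 0 = 1"
  and radix_prod_Suc [simp]: "radix_prod c (Suc k) = radix_prod c k * real (c k)"
  by (simp_all add: radix_prod_def)

lemma cell_index_cong: "(\<And>l. l < k \<Longrightarrow> a l = b l) \<Longrightarrow> cell_index c a k = cell_index c b k"
  by (induction k) auto

lemma cell_index_digits_eq:
  assumes "\<And>l. l < k \<Longrightarrow> a l < c l" "\<And>l. l < k \<Longrightarrow> b l < c l"
    and "cell_index c a k = cell_index c b k" "l < k"
  shows "a l = b l"
  using assms
proof (induction k arbitrary: l)
  case (Suc k)
  have "a k < c k" "b k < c k" "c k * cell_index c a k + a k = c k * cell_index c b k + b k"
    using Suc.prems by auto
  then have "a k = b k" "cell_index c a k = cell_index c b k"
    by (metis mod_mult_self4 mod_less, metis div_mult_self4 div_less add_0_right not_less_zero)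
  with Suc show ?case by (cases "l = k") (auto simp: less_Suc_eq)
qed simp

text \<open>
  Passing from level \<open>k\<close> to level \<open>k + 1\<close> turns an index \<open>v\<close> into \<open>c k * v + s\<close> with an admissible digit
  \<open>s\<close>, so each step multiplies the number of indices by at most the number of digits. Counting indices in
  place of digit strings avoids any bookkeeping of the digits below level \<open>k0\<close>.
\<close>
lemma card_cell_index_extensions:
  fixes c :: "nat \<Rightarrow> nat" and S :: "nat \<Rightarrow> nat set"
  assumes "finite J" "\<And>l. finite (S l)" "k0 \<le> k"
  defines "V \<equiv> \<lambda>k. {cell_index c a k |a. cell_index c a k0 \<in> J \<and> (\<forall>l\<in>{k0..<k}. a l \<in> S l)}"
  shows "finite (V k) \<and> card (V k) \<le> card J * (\<Prod>l\<in>{k0..<k}. card (S l))"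
  using assms(3)
proof (induction k rule: dec_induct)
  case base
  have "V k0 \<subseteq> J" by (auto simp: V_def)
  then show ?case using assms(1) by (auto intro: card_mono finite_subset)
next
  case (step k)
  let ?f = "\<lambda>(v, s). c k * v + s"
  have sub: "V (Suc k) \<subseteq> ?f ` (V k \<times> S k)"
    using step(1) by (fastforce simp: V_def image_iff)
  have fin: "finite (V k \<times> S k)" using step assms(2) by blast
  have "card (V (Suc k)) \<le> card (V k \<times> S k)"
    using card_mono[OF finite_imageI[OF fin] sub] card_image_le[OF fin, of ?f] by linarith
  also have "\<dots> \<le> (card J * (\<Prod>l\<in>{k0..<k}. card (S l))) * card (S k)"
    using step by (simp add: card_cartesian_product)
  also have "\<dots> = card J * (\<Prod>l\<in>{k0..<Suc k}. card (S l))"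
    using step(1) by simp
  finally show ?case using finite_subset[OF sub finite_imageI[OF fin]] by simp
qed

lemma card_le_of_spread:
  fixes S :: "nat set"
  assumes "\<And>u v. u \<in> S \<Longrightarrow> v \<in> S \<Longrightarrow> u \<le> v + d"
  shows "finite S" "card S \<le> Suc d"
proof -
  have sub: "S \<subseteq> {Inf S..Inf S + d}"
  proof
    fix u assume u: "u \<in> S"
    then have "Inf S \<in> S" using Inf_nat_def1 by blast
    then show "u \<in> {Inf S..Inf S + d}" using assms[OF u] u by (auto intro: cInf_lower)
  qed
  then show "finite S" by (rule finite_subset) simp
  show "card S \<le> Suc d" using card_mono[OF _ sub] by simp
qed

locale bounded_radix =
  fixes c :: "nat \<Rightarrow> nat" and Q :: nat
  assumes two_le: "2 \<le> c l" and le_bound: "c l \<le> Q"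
begin

lemma radix_prod_pos [simp]: "0 < radix_prod c k"
  unfolding radix_prod_def using two_le by (intro prod_pos) (metis of_nat_0_less_iff less_le_trans zero_less_numeral)

lemma radix_prod_nz [simp]: "radix_prod c k \<noteq> 0"
  using radix_prod_pos[of k] by linarith

lemma radix_prod_strict_mono: "strict_mono (radix_prod c)"
proof (rule strict_mono_Suc_iff[THEN iffD2], intro allI)
  fix k
  have "1 < real (c k)" using two_le[of k] by linarith
  then show "radix_prod c k < radix_prod c (Suc k)" by simp
qed

lemma radix_prod_ge: "2 ^ k \<le> radix_prod c k"
proof -
  have "(\<Prod>l<k. 2::real) \<le> (\<Prod>l<k. real (c l))"
    using two_le by (intro prod_mono) (auto simp: numeral_le_real_of_nat_iff)
  then show ?thesis by (simp add: radix_prod_def)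
qed

lemma radix_prod_add_le:
  assumes "k \<le> k'" shows "radix_prod c k' \<le> radix_prod c k * real Q ^ (k' - k)"
  using assms
proof (induction k' rule: dec_induct)
  case (step k')
  have "radix_prod c k' * real (c k') \<le> radix_prod c k * real Q ^ (k' - k) * real Q"
    using step le_bound by (intro mult_mono) (auto simp: less_imp_le)
  then show ?case using step by (simp add: Suc_diff_le mult_ac)
qed simp

lemma radix_prod_bracket:
  assumes "1 \<le> t" obtains k where "radix_prod c k \<le> t" "t < radix_prod c (Suc k)"
proof -
  obtain k1 where "t < 2 ^ k1" using real_arch_pow[of 2 t] by auto
  then have ex: "\<exists>k. t < radix_prod c k" using radix_prod_ge[of k1] by (intro exI[of _ k1]) linarith
  define h where "h = (LEAST k. t < radix_prod c k)"
  have h: "t < radix_prod c h" unfolding h_def by (rule LeastI_ex[OF ex])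
  then obtain k where k: "h = Suc k" using assms by (cases h) auto
  then have "\<not> t < radix_prod c k" using not_less_Least[of k "\<lambda>k. t < radix_prod c k"] h_def by simp
  then show ?thesis using that[of k] h k by simp
qed

lemma prod_le_radix_powr:
  assumes "\<And>l. 0 \<le> g l" "\<And>l. g l \<le> real (c l) powr \<alpha>" "k0 \<le> k"
  shows "(\<Prod>l\<in>{k0..<k}. g l) \<le> (radix_prod c k / radix_prod c k0) powr \<alpha>"
  using assms(3)
proof (induction k rule: dec_induct)
  case (step k)
  have "(\<Prod>l\<in>{k0..<k}. g l) * g k \<le> (radix_prod c k / radix_prod c k0) powr \<alpha> * real (c k) powr \<alpha>"
    using step assms(1,2) by (intro mult_mono prod_nonneg) auto
  also have "\<dots> = (radix_prod c (Suc k) / radix_prod c k0) powr \<alpha>"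
    by (subst powr_mult[symmetric]) (auto simp: less_imp_le)
  finally show ?case using step by simp
qed simp

lemma radix_cell_antimono:
  assumes "k \<le> k'" "\<And>l. l < k' \<Longrightarrow> a l < c l"
  shows "radix_cell c a k' \<subseteq> radix_cell c a k"
  using assms
proof (induction k' rule: dec_induct)
  case (step k')
  have c0: "0 < real (c k')" using two_le[of k'] by simp
  have "real (a k') + 1 \<le> real (c k')" using step.prems[of k'] by linarith
  then have hi: "real (cell_index c a (Suc k')) + 1 \<le> (real (cell_index c a k') + 1) * real (c k')"
    by (simp add: algebra_simps)
  have "(real (cell_index c a (Suc k')) + 1) / radix_prod c (Suc k')
      \<le> (real (cell_index c a k') + 1) * real (c k') / radix_prod c (Suc k')"
    by (rule divide_right_mono[OF hi]) (simp add: less_imp_le)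
  moreover have "real (cell_index c a k') / radix_prod c k'
      \<le> real (cell_index c a (Suc k')) / radix_prod c (Suc k')"
    using c0 by (simp add: field_simps)
  ultimately have "radix_cell c a (Suc k') \<subseteq> radix_cell c a k'"
    using c0 by (auto simp: radix_cell_def)
  then show ?case using step by auto
qed simp

lemma radix_value_in_cell:
  assumes "\<And>l. a l < c l"
  shows "radix_value c a \<in> radix_cell c a k"
proof -
  let ?lo = "\<lambda>k. real (cell_index c a k) / radix_prod c k"
  let ?hi = "\<lambda>k. (real (cell_index c a k) + 1) / radix_prod c k"
  have lohi: "?lo i \<le> ?hi j" for i j
  proof -
    have "?lo (max i j) \<in> radix_cell c a (max i j)"
      by (auto simp: radix_cell_def divide_right_mono less_imp_le)
    then have "?lo (max i j) \<in> radix_cell c a j"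
      using radix_cell_antimono[of j "max i j" a] assms by auto
    moreover have "?lo (max i j) \<in> radix_cell c a i"
      using \<open>?lo (max i j) \<in> radix_cell c a (max i j)\<close> radix_cell_antimono[of i "max i j" a] assms by auto
    ultimately show ?thesis by (auto simp: radix_cell_def)
  qed
  have "?lo k \<le> radix_value c a" unfolding radix_value_def
    by (rule cSUP_upper) (auto intro!: bdd_aboveI2[of _ _ "?hi 0"] lohi simp del: radix_prod_0 cell_index.simps)
  moreover have "radix_value c a \<le> ?hi k" unfolding radix_value_def
    by (rule cSUP_least) (auto intro: lohi)
  ultimately show ?thesis by (simp add: radix_cell_def)
qed

lemma radix_cell_dist:
  assumes "s \<in> radix_cell c a k" "t \<in> radix_cell c a k"
  shows "\<bar>s - t\<bar> \<le> 1 / radix_prod c k"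
  using assms by (auto simp: radix_cell_def add_divide_distrib)

text \<open>
  A set of diameter at most \<open>e\<close> meets only boundedly many cells whose length is at least comparable to \<open>e\<close>.
  Cells are closed, so neighbours share an end point; hence \<open>d + 2\<close>. Used with \<open>e = 2 * R\<close> for a ball in the upper
  bound and with \<open>e = r\<close> for a covering set in the lower bound.
\<close>
lemma card_cells_meeting:
  assumes "\<And>s t. s \<in> T \<Longrightarrow> t \<in> T \<Longrightarrow> \<bar>s - t\<bar> \<le> e" "radix_prod c k * e \<le> real d"
  defines "J \<equiv> {u :: nat. \<exists>s\<in>T. real u / radix_prod c k \<le> s \<and> s \<le> (real u + 1) / radix_prod c k}"
  shows "finite J" "card J \<le> d + 2"
proof -
  have "u \<le> v + (d + 1)" if uv: "u \<in> J" "v \<in> J" for u v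
  proof -
    obtain s where s: "s \<in> T" "real u / radix_prod c k \<le> s" using uv by (auto simp: J_def)
    obtain t where t: "t \<in> T" "t \<le> (real v + 1) / radix_prod c k" using uv by (auto simp: J_def)
    have st: "s \<in> T" "t \<in> T" "real u \<le> radix_prod c k * s" "radix_prod c k * t \<le> real v + 1"
      using s t by (simp_all add: field_simps)
    have "radix_prod c k * (s - t) \<le> radix_prod c k * e"
      using assms(1)[OF st(1,2)] by (intro mult_left_mono) (auto simp: less_imp_le)
    then have "real u \<le> real (v + (d + 1))"
      using st assms(2) by (simp add: algebra_simps)
    then show ?thesis by linarith
  qed
  from card_le_of_spread[of J "d + 1", OF this] show "finite J" "card J \<le> d + 2" by auto
qed

end

section \<open>Counting approximate squares of the attractor\<close>

lemma covering_number_le: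
  assumes "finite \<U>" "\<And>U. U \<in> \<U> \<Longrightarrow> bounded U \<and> diameter U \<le> r" "F \<subseteq> \<Union>\<U>"
  shows "covering_number r F \<le> card \<U>"
  unfolding covering_number_def using assms by (intro Least_le) blast

text \<open>
  The minimum in \<^const>\<open>covering_number\<close> ranges over a non-empty set because bounded sets in the plane are
  totally bounded.
\<close>
lemma covering_number_attained:
  assumes "bounded F" "0 < r"
  obtains \<U> where "finite \<U>" "card \<U> = covering_number r F"
    "\<And>U. U \<in> \<U> \<Longrightarrow> bounded U \<and> diameter U \<le> r" "F \<subseteq> \<Union>\<U>"
proof -
  have "compact (closure F)" using assms(1) by simp
  moreover have "0 < r / 2" using assms(2) by simp
  ultimately obtain X where X: "finite X" "closure F \<subseteq> (\<Union>x\<in>X. ball x (r / 2))"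
    using seq_compact_imp_totally_bounded[of "closure F"] compact_imp_seq_compact by blast
  let ?P = "\<lambda>k. \<exists>\<U>. finite \<U> \<and> card \<U> = k \<and> (\<forall>U\<in>\<U>. bounded U \<and> diameter U \<le> r) \<and> F \<subseteq> \<Union>\<U>"
  have "?P (card ((\<lambda>x. ball x (r / 2)) ` X))"
    using X assms(2) closure_subset[of F] by (intro exI[of _ "(\<lambda>x. ball x (r / 2)) ` X"]) auto
  then have "?P (covering_number r F)" unfolding covering_number_def by (rule LeastI)
  then show ?thesis using that by blast
qed

text \<open>
  The deterministic part concerns one fixed letter sequence. \<open>M k\<close> and \<open>H k\<close> below are the reciprocals of the
  width and of the height of a cylinder of level \<open>k\<close>. Since widths shrink more slowly than heights, an
  approximate square combines a column of some level with a row of a smaller level.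
\<close>
locale bm_sequence =
  fixes m n :: "nat \<Rightarrow> nat" and D :: "nat \<Rightarrow> (nat \<times> nat) set" and \<omega> :: "nat \<Rightarrow> nat" and Q :: nat
  assumes two_le_m: "2 \<le> m (\<omega> l)" and m_less_n: "m (\<omega> l) < n (\<omega> l)" and n_le: "n (\<omega> l) \<le> Q"
    and D_subset: "D (\<omega> l) \<subseteq> {0..<m (\<omega> l)} \<times> {0..<n (\<omega> l)}" and D_nonempty: "D (\<omega> l) \<noteq> {}"
begin

sublocale col: bounded_radix "\<lambda>l. m (\<omega> l)" Q
  using le_trans[OF less_imp_le[OF m_less_n] n_le] two_le_m by unfold_locales auto

sublocale row: bounded_radix "\<lambda>l. n (\<omega> l)" Q
  using le_trans[OF two_le_m less_imp_le[OF m_less_n]] n_le by unfold_locales auto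

abbreviation F where "F \<equiv> bm_attractor m n D \<omega>"
abbreviation M where "M \<equiv> radix_prod (\<lambda>l. m (\<omega> l))"
abbreviation H where "H \<equiv> radix_prod (\<lambda>l. n (\<omega> l))"
abbreviation col_index where "col_index \<equiv> cell_index (\<lambda>l. m (\<omega> l))"
abbreviation row_index where "row_index \<equiv> cell_index (\<lambda>l. n (\<omega> l))"
abbreviation col_cell where "col_cell \<equiv> radix_cell (\<lambda>l. m (\<omega> l))"
abbreviation row_cell where "row_cell \<equiv> radix_cell (\<lambda>l. n (\<omega> l))"

lemma M_le_H: "M k \<le> H k"
  unfolding radix_prod_def using m_less_n by (intro prod_mono) (auto simp: less_imp_le)

lemma digit_bounds:
  assumes "d \<in> D (\<omega> l)" shows "fst d < m (\<omega> l)" "snd d < n (\<omega> l)"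
  using assms D_subset[of l] by auto

lemma finite_D: "finite (D (\<omega> l))"
  using D_subset[of l] finite_subset by blast

lemma finite_section: "finite {b. (a, b) \<in> D (\<omega> l)}"
  using finite_imageI[OF finite_D, of snd l] by (rule rev_finite_subset) force

lemma card_column: "card {d \<in> D (\<omega> l). fst d = a} = card {b. (a, b) \<in> D (\<omega> l)}"
proof -
  have "{d \<in> D (\<omega> l). fst d = a} = Pair a ` {b. (a, b) \<in> D (\<omega> l)}" by auto
  then show ?thesis by (simp add: card_image inj_on_def)
qed

lemma card_section_le: "card {b. (a, b) \<in> D (\<omega> l)} \<le> max_in_column (m (\<omega> l)) (D (\<omega> l))"
proof (cases "a < m (\<omega> l)")
  case True
  then show ?thesis unfolding max_in_column_def card_column[symmetric]
    by (intro Max_ge) auto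
next
  case False
  then have "{b. (a, b) \<in> D (\<omega> l)} = {}" using D_subset[of l] by auto
  then show ?thesis by simp
qed

lemma obtain_max_column:
  obtains a where "card {b. (a, b) \<in> D (\<omega> l)} = max_in_column (m (\<omega> l)) (D (\<omega> l))"
    "\<exists>b. (a, b) \<in> D (\<omega> l)"
proof -
  have "max_in_column (m (\<omega> l)) (D (\<omega> l)) \<in> (\<lambda>k. card {d \<in> D (\<omega> l). fst d = k}) ` {0..<m (\<omega> l)}"
    unfolding max_in_column_def using two_le_m[of l] by (intro Max_in) auto
  then obtain a where a: "card {b. (a, b) \<in> D (\<omega> l)} = max_in_column (m (\<omega> l)) (D (\<omega> l))"
    by (auto simp: card_column)
  obtain d where "d \<in> D (\<omega> l)" using D_nonempty[of l] by auto
  then have "{b. (fst d, b) \<in> D (\<omega> l)} \<noteq> {}" by (cases d) auto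
  then have "0 < card {b. (fst d, b) \<in> D (\<omega> l)}" using finite_section[of "fst d" l] by (simp add: card_gt_0_iff)
  then have "0 < card {b. (a, b) \<in> D (\<omega> l)}" using card_section_le[of "fst d" l] a by linarith
  then have "{b. (a, b) \<in> D (\<omega> l)} \<noteq> {}" by (metis card.empty less_irrefl)
  with a show ?thesis using that by blast
qed

lemma bm_comp_eq:
  "bm_comp m n \<omega> d k (x, y) =
     ((real (col_index (\<lambda>l. fst (d l)) k) + x) / M k, (real (row_index (\<lambda>l. snd (d l)) k) + y) / H k)"
proof (induction k arbitrary: x y)
  case (Suc k)
  have "real (m (\<omega> k)) \<noteq> 0" "real (n (\<omega> k)) \<noteq> 0"
    using col.two_le[of k] row.two_le[of k] by auto
  then show ?case by (simp add: Suc bm_map_def field_simps)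
qed simp

lemma attractor_in_cells:
  assumes "z \<in> F"
  obtains d where "\<And>l. l < k \<Longrightarrow> d l \<in> D (\<omega> l)"
    "\<And>l. l \<le> k \<Longrightarrow> fst z \<in> col_cell (\<lambda>i. fst (d i)) l"
    "\<And>l. l \<le> k \<Longrightarrow> snd z \<in> row_cell (\<lambda>i. snd (d i)) l"
proof -
  obtain d x y where d: "\<forall>l<Suc k. d l \<in> D (\<omega> l)" and xy: "x \<in> {0..1}" "y \<in> {0..1}"
    and z: "z = bm_comp m n \<omega> d (Suc k) (x, y)"
  proof -
    have "z \<in> (\<Union>d\<in>{d. \<forall>l<Suc k. d l \<in> D (\<omega> l)}. bm_comp m n \<omega> d (Suc k) ` ({0..1} \<times> {0..1}))"
      using assms unfolding bm_attractor_def by (rule INT_D) simp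
    then show thesis using that by blast
  qed
  have "fst z \<in> col_cell (\<lambda>i. fst (d i)) (Suc k)" "snd z \<in> row_cell (\<lambda>i. snd (d i)) (Suc k)"
    unfolding z bm_comp_eq radix_cell_def using xy
    by (auto simp: less_imp_le simp del: radix_prod_Suc cell_index.simps intro!: divide_right_mono)
  moreover have "col_cell (\<lambda>i. fst (d i)) (Suc k) \<subseteq> col_cell (\<lambda>i. fst (d i)) l"
    "row_cell (\<lambda>i. snd (d i)) (Suc k) \<subseteq> row_cell (\<lambda>i. snd (d i)) l" if "l \<le> k" for l
    using that d digit_bounds
    by (intro col.radix_cell_antimono row.radix_cell_antimono; simp)+
  ultimately show ?thesis using d by (intro that[of d]) (auto simp del: radix_prod_Suc cell_index.simps)
qed

lemma digit_point_in_attractor: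
  assumes "\<And>l. d l \<in> D (\<omega> l)"
  shows "(radix_value (\<lambda>l. m (\<omega> l)) (\<lambda>l. fst (d l)), radix_value (\<lambda>l. n (\<omega> l)) (\<lambda>l. snd (d l))) \<in> F"
    (is "(?x, ?y) \<in> F")
proof -
  have "(?x, ?y) \<in> bm_comp m n \<omega> d k ` ({0..1} \<times> {0..1})" for k
  proof (rule image_eqI)
    let ?u = "real (col_index (\<lambda>l. fst (d l)) k)" and ?v = "real (row_index (\<lambda>l. snd (d l)) k)"
    show "(?x, ?y) = bm_comp m n \<omega> d k (M k * ?x - ?u, H k * ?y - ?v)"
      by (simp add: bm_comp_eq)
    have "?x \<in> col_cell (\<lambda>l. fst (d l)) k" "?y \<in> row_cell (\<lambda>l. snd (d l)) k"
      using col.radix_value_in_cell row.radix_value_in_cell digit_bounds assms by auto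
    then show "(M k * ?x - ?u, H k * ?y - ?v) \<in> {0..1} \<times> {0..1}"
      by (auto simp: radix_cell_def field_simps)
  qed
  then show ?thesis using assms unfolding bm_attractor_def by (intro INT_I UN_I[of d]) simp_all
qed

lemma diameter_rectangle_le:
  assumes "b - a \<le> r / 2" "d - c \<le> r / 2" "0 \<le> r"
  shows "bounded ({a..b} \<times> {c..d::real})" "diameter ({a..b::real} \<times> {c..d}) \<le> r"
proof -
  show "bounded ({a..b} \<times> {c..d})" by (intro bounded_Times) auto
  have "norm (p - q) \<le> r" if "p \<in> {a..b} \<times> {c..d}" "q \<in> {a..b} \<times> {c..d}" for p q :: "real \<times> real"
  proof -
    have "norm (p - q) \<le> \<bar>fst p - fst q\<bar> + \<bar>snd p - snd q\<bar>"
      using sqrt_sum_squares_le_sum_abs by (simp add: norm_prod_def)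
    also have "\<dots> \<le> r" using that assms by (auto simp: abs_le_iff)
    finally show ?thesis .
  qed
  then show "diameter ({a..b} \<times> {c..d}) \<le> r" using assms(3) by (intro diameter_le) auto
qed

text \<open>
  Cover by approximate squares of side about \<open>r\<close>: columns of level \<open>K1\<close> and rows of level \<open>K2\<close>. The ball meets
  a bounded number of columns of level \<open>k1\<close> and rows of level \<open>k2\<close>, the levels belonging to \<open>R\<close>. Refining
  the columns costs a factor of at most \<open>num_columns\<close> per level. Once the column is known down to level
  \<open>K1 \<ge> K2\<close>, its column digits are known at all the levels where rows are refined, so each of
  these levels costs at most \<open>max_in_column\<close>. The two factors are products over \<open>k1..<K1\<close> and \<open>k2..<K2\<close>, and each of
  them is a power of \<open>R / r\<close> up to a constant.
\<close>
lemma covering_number_attractor_le: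
  assumes A: "\<And>l. real (num_columns (D (\<omega> l))) \<le> real (m (\<omega> l)) powr \<alpha>"
    and B: "\<And>l. real (max_in_column (m (\<omega> l)) (D (\<omega> l))) \<le> real (n (\<omega> l)) powr \<beta>"
    and ab: "0 \<le> \<alpha>" "0 \<le> \<beta>" and r: "0 < r" "r < R" "R \<le> 1"
  shows "real (covering_number r (cball z R \<inter> F)) \<le> 16 * (2 * real Q ^ 2) powr (\<alpha> + \<beta>) * (R / r) powr (\<alpha> + \<beta>)"
proof -
  have R0: "0 < R" using r by simp
  have lt: "1 / R < 2 / r" using r by (simp add: field_simps)
  have t: "1 \<le> 1 / R" "1 \<le> 2 / r" using r by (auto simp: field_simps)
  obtain k1 where k1: "M k1 \<le> 1 / R" "1 / R < M (Suc k1)" using col.radix_prod_bracket[OF t(1)] .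
  obtain k2 where k2: "H k2 \<le> 1 / R" "1 / R < H (Suc k2)" using row.radix_prod_bracket[OF t(1)] .
  obtain i1 where i1: "M i1 \<le> 2 / r" "2 / r < M (Suc i1)" using col.radix_prod_bracket[OF t(2)] .
  obtain i2 where i2: "H i2 \<le> 2 / r" "2 / r < H (Suc i2)" using row.radix_prod_bracket[OF t(2)] .
  define K1 where "K1 = Suc i1"
  define K2 where "K2 = Suc i2"
  have "M i2 < M (Suc i1)" using M_le_H[of i2] i1 i2 by linarith
  then have "i2 < Suc i1" using strict_mono_less[OF col.radix_prod_strict_mono] by blast
  then have K21: "K2 \<le> K1" by (simp add: K1_def K2_def)
  have "M k1 < M K1" using k1 i1 lt by (simp only: K1_def)
  then have kK1: "k1 \<le> K1" using strict_mono_less[OF col.radix_prod_strict_mono] less_imp_le by blast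
  have "H k2 < H K2" using k2 i2 lt by (simp only: K2_def)
  then have kK2: "k2 \<le> K2" using strict_mono_less[OF row.radix_prod_strict_mono] less_imp_le by blast
  define I1 where "I1 = {u :: nat. \<exists>s\<in>cball (fst z) R. real u / M k1 \<le> s \<and> s \<le> (real u + 1) / M k1}"
  define I2 where "I2 = {u :: nat. \<exists>s\<in>cball (snd z) R. real u / H k2 \<le> s \<and> s \<le> (real u + 1) / H k2}"
  have near: "\<bar>s - t\<bar> \<le> 2 * R" if "s \<in> cball x R" "t \<in> cball x R" for s t x :: real
    using that by (auto simp: dist_real_def)
  have "M k1 * (2 * R) \<le> real 2" "H k2 * (2 * R) \<le> real 2" using k1 k2 R0 by (auto simp: field_simps)
  then have I: "finite I1" "card I1 \<le> 4" "finite I2" "card I2 \<le> 4"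
    using col.card_cells_meeting[of "cball (fst z) R" "2 * R" k1 2, OF near]
      row.card_cells_meeting[of "cball (snd z) R" "2 * R" k2 2, OF near]
    by (auto simp: I1_def I2_def)
  \<comment> \<open>The digits of a column index; they are unique once they are bounded by the bases.\<close>
  define dig where "dig = (\<lambda>u. SOME a. (\<forall>l<K1. a l < m (\<omega> l)) \<and> col_index a K1 = u)"
  define Z1 where "Z1 = {col_index a K1 |a. col_index a k1 \<in> I1 \<and> (\<forall>l\<in>{k1..<K1}. a l \<in> fst ` D (\<omega> l))}"
  define Z2 where "Z2 = (\<lambda>u. {row_index b K2 |b. row_index b k2 \<in> I2 \<and> (\<forall>l\<in>{k2..<K2}. b l \<in> {b. (dig u l, b) \<in> D (\<omega> l)})})"
  define rect where "rect = (\<lambda>(u, v). {real u / M K1..(real u + 1) / M K1} \<times> {real v / H K2..(real v + 1) / H K2})"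
  let ?PA = "\<Prod>l\<in>{k1..<K1}. num_columns (D (\<omega> l))"
  let ?PB = "\<Prod>l\<in>{k2..<K2}. max_in_column (m (\<omega> l)) (D (\<omega> l))"
  have Z1: "finite Z1" "card Z1 \<le> 4 * ?PA"
  proof -
    have *: "finite Z1 \<and> card Z1 \<le> card I1 * ?PA"
      unfolding Z1_def num_columns_def
      by (rule card_cell_index_extensions) (use I kK1 finite_D in auto)
    then show "finite Z1" by simp
    have "card I1 * ?PA \<le> 4 * ?PA" using I by (intro mult_right_mono) auto
    with * show "card Z1 \<le> 4 * ?PA" by linarith
  qed
  have Z2: "finite (Z2 u)" "card (Z2 u) \<le> 4 * ?PB" for u
  proof -
    have *: "finite (Z2 u) \<and> card (Z2 u) \<le> card I2 * (\<Prod>l\<in>{k2..<K2}. card {b. (dig u l, b) \<in> D (\<omega> l)})"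
      unfolding Z2_def
      by (rule card_cell_index_extensions) (use I kK2 finite_section in auto)
    then show "finite (Z2 u)" by simp
    have "card I2 * (\<Prod>l\<in>{k2..<K2}. card {b. (dig u l, b) \<in> D (\<omega> l)}) \<le> 4 * ?PB"
      using I card_section_le by (intro mult_mono prod_mono) auto
    with * show "card (Z2 u) \<le> 4 * ?PB" by linarith
  qed
  have "cball z R \<inter> F \<subseteq> \<Union> (rect ` Sigma Z1 Z2)"
  proof
    fix w assume w: "w \<in> cball z R \<inter> F"
    obtain d where d: "\<And>l. l < K1 \<Longrightarrow> d l \<in> D (\<omega> l)"
      "\<And>l. l \<le> K1 \<Longrightarrow> fst w \<in> col_cell (\<lambda>i. fst (d i)) l"
      "\<And>l. l \<le> K1 \<Longrightarrow> snd w \<in> row_cell (\<lambda>i. snd (d i)) l"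
      using attractor_in_cells[of w K1] w by blast
    let ?a = "\<lambda>i. fst (d i)" and ?b = "\<lambda>i. snd (d i)"
    have wz: "fst w \<in> cball (fst z) R" "snd w \<in> cball (snd z) R"
      using w dist_fst_le[of z w] dist_snd_le[of z w] by auto
    have "col_index ?a k1 \<in> I1" unfolding I1_def
      using wz d(2)[OF kK1] by (auto simp: radix_cell_def)
    then have u: "col_index ?a K1 \<in> Z1" unfolding Z1_def using d(1) by force
    have "(\<forall>l<K1. dig (col_index ?a K1) l < m (\<omega> l)) \<and> col_index (dig (col_index ?a K1)) K1 = col_index ?a K1"
      unfolding dig_def by (rule someI[of _ ?a]) (use d(1) digit_bounds in auto)
    then have dig: "dig (col_index ?a K1) l = ?a l" if "l < K1" for l
      using cell_index_digits_eq[of K1 "dig (col_index ?a K1)" "\<lambda>l. m (\<omega> l)" ?a l] that d(1) digit_bounds by auto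
    have "row_index ?b k2 \<in> I2" unfolding I2_def
      using wz d(3)[of k2] kK2 K21 by (auto simp: radix_cell_def)
    then have v: "row_index ?b K2 \<in> Z2 (col_index ?a K1)"
      unfolding Z2_def using d(1) dig K21 by (intro CollectI exI[of _ ?b]) auto
    have "w \<in> rect (col_index ?a K1, row_index ?b K2)"
      using d(2)[of K1] d(3)[of K2] K21 by (cases w) (auto simp: rect_def radix_cell_def)
    with u v show "w \<in> \<Union> (rect ` Sigma Z1 Z2)" by blast
  qed
  moreover have "bounded U \<and> diameter U \<le> r" if "U \<in> rect ` Sigma Z1 Z2" for U
  proof -
    have "1 / M K1 \<le> r / 2" "1 / H K2 \<le> r / 2"
      using i1(2) i2(2) r(1) by (auto simp: K1_def K2_def field_simps simp del: radix_prod_Suc)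
    then show ?thesis using that r(1)
      by (auto simp: rect_def add_divide_distrib intro!: diameter_rectangle_le bounded_Times)
  qed
  ultimately have "covering_number r (cball z R \<inter> F) \<le> card (rect ` Sigma Z1 Z2)"
    using Z1 Z2 by (intro covering_number_le) auto
  also have "\<dots> \<le> card (Sigma Z1 Z2)" using Z1 Z2 by (intro card_image_le) auto
  also have "\<dots> = (\<Sum>u\<in>Z1. card (Z2 u))" using Z1 Z2 by (intro card_SigmaI) auto
  also have "\<dots> \<le> card Z1 * (4 * ?PB)" using sum_bounded_above[of Z1 "\<lambda>u. card (Z2 u)"] Z2 by simp
  also have "\<dots> \<le> (4 * ?PA) * (4 * ?PB)" using Z1 by (intro mult_right_mono) auto
  finally have "real (covering_number r (cball z R \<inter> F)) \<le> real ((4 * ?PA) * (4 * ?PB))"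
    by (rule of_nat_mono)
  also have "\<dots> = 16 * (\<Prod>l\<in>{k1..<K1}. real (num_columns (D (\<omega> l)))) *
      (\<Prod>l\<in>{k2..<K2}. real (max_in_column (m (\<omega> l)) (D (\<omega> l))))" by simp
  also have "\<dots> \<le> 16 * (M K1 / M k1) powr \<alpha> * (H K2 / H k2) powr \<beta>"
    using col.prod_le_radix_powr[of "\<lambda>l. real (num_columns (D (\<omega> l)))", OF _ A kK1]
      row.prod_le_radix_powr[of "\<lambda>l. real (max_in_column (m (\<omega> l)) (D (\<omega> l)))", OF _ B kK2]
    by (intro mult_mono) (auto intro!: prod_nonneg)
  also have "\<dots> \<le> 16 * (2 * real Q ^ 2 * (R / r)) powr \<alpha> * (2 * real Q ^ 2 * (R / r)) powr \<beta>"
  proof -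
    have ratio: "p' * q / p \<le> 2 * real Q ^ 2 * (R / r)"
      if "0 < p" "0 < p'" "1 / R < p * q0" "p' \<le> 2 / r" "q0 \<le> Q" "q \<le> real Q" "0 < q" "0 < q0" for p p' q q0 :: real
    proof -
      have "p * q0 \<le> p * Q" using that by (intro mult_left_mono) auto
      then have "1 / R < p * Q" using that by linarith
      then have "1 / p \<le> real Q * R" using that R0 by (simp add: field_simps)
      moreover have "p' * q \<le> 2 / r * real Q" using that r(1) by (intro mult_mono) auto
      ultimately have "p' * q * (1 / p) \<le> (2 / r * real Q) * (real Q * R)"
        using that r(1) by (intro mult_mono) auto
      then show ?thesis by (simp add: power2_eq_square mult_ac)
    qed
    have pos: "0 < real (m (\<omega> l))" "0 < real (n (\<omega> l))" for l
      using col.two_le[of l] row.two_le[of l] by auto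
    have "M K1 / M k1 \<le> 2 * real Q ^ 2 * (R / r)"
      unfolding K1_def radix_prod_Suc
      by (rule ratio[of _ _ "real (m (\<omega> k1))"]) (use k1 i1 pos col.le_bound in auto)
    moreover have "H K2 / H k2 \<le> 2 * real Q ^ 2 * (R / r)"
      unfolding K2_def radix_prod_Suc
      by (rule ratio[of _ _ "real (n (\<omega> k2))"]) (use k2 i2 pos row.le_bound in auto)
    ultimately show ?thesis using ab
      by (intro mult_mono powr_mono2) (auto simp: less_imp_le)
  qed
  also have "\<dots> = 16 * (2 * real Q ^ 2) powr (\<alpha> + \<beta>) * (R / r) powr (\<alpha> + \<beta>)"
    by (simp only: powr_add[symmetric] powr_mult[symmetric] mult.assoc)
  finally show ?thesis .
qed

text \<open>
  A family of points that a small set cannot share: at the levels \<open>k..<k'\<close> the column digit is that of a fullest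
  column and the row digit is free; at the levels \<open>h..<h'\<close> the column digit is free; all other digits are
  fixed. The points agree in their columns up to level \<open>h\<close> and in their rows up to level \<open>k\<close>, so they lie in one
  approximate square of side \<open>1 / H k\<close>. They are told apart by their column of level \<open>h'\<close> and their row of level
  \<open>k'\<close>, and a set of diameter at most \<open>r\<close> meets at most three of each. Because \<open>k' \<le> h\<close>, the free row digits do not
  disturb the free column digits.
\<close>
lemma covering_number_attractor_ge:
  assumes lev: "k \<le> k'" "k' \<le> h" "h \<le> h'" and HM: "H k \<le> M h"
    and r: "0 < r" "M h' * r \<le> 1" "H k' * r \<le> 1"
  obtains z where "z \<in> F"
    "(\<Prod>l\<in>{h..<h'}. num_columns (D (\<omega> l))) * (\<Prod>l\<in>{k..<k'}. max_in_column (m (\<omega> l)) (D (\<omega> l)))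
       \<le> 9 * covering_number r (cball z (2 / H k) \<inter> F)"
proof -
  \<comment> \<open>\<open>(a0 l, b0 l)\<close> is a rectangle in a fullest column of level \<open>l\<close>.\<close>
  have "\<forall>l. \<exists>a b. card {b. (a, b) \<in> D (\<omega> l)} = max_in_column (m (\<omega> l)) (D (\<omega> l)) \<and> (a, b) \<in> D (\<omega> l)"
    by (metis obtain_max_column)
  then obtain a0 b0 where ab: "\<And>l. card {b. (a0 l, b) \<in> D (\<omega> l)} = max_in_column (m (\<omega> l)) (D (\<omega> l))"
    "\<And>l. (a0 l, b0 l) \<in> D (\<omega> l)" by metis
  define dig where "dig = (\<lambda>(a, b) l. if l \<in> {k..<k'} then (a0 l, b l)
     else if l \<in> {h..<h'} then (a l, SOME b. (a l, b) \<in> D (\<omega> l)) else (a0 l, b0 l))"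
  define T where "T = PiE {h..<h'} (\<lambda>l. fst ` D (\<omega> l)) \<times> PiE {k..<k'} (\<lambda>l. {b. (a0 l, b) \<in> D (\<omega> l)})"
  have digD: "dig t l \<in> D (\<omega> l)" if t: "t \<in> T" for t l
  proof -
    obtain a b where [simp]: "t = (a, b)" by (cases t)
    have "l \<in> {k..<k'} \<Longrightarrow> (a0 l, b l) \<in> D (\<omega> l)" using t by (auto simp: T_def PiE_def Pi_def)
    moreover have "(a l, SOME b. (a l, b) \<in> D (\<omega> l)) \<in> D (\<omega> l)" if "l \<in> {h..<h'}"
    proof -
      have "a l \<in> fst ` D (\<omega> l)" using t that by (auto simp: T_def PiE_def Pi_def)
      then show ?thesis by (intro someI_ex[of "\<lambda>b. (a l, b) \<in> D (\<omega> l)"]) auto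
    qed
    ultimately show ?thesis using ab(2) by (auto simp: dig_def)
  qed
  define px where "px = (\<lambda>t. radix_value (\<lambda>l. m (\<omega> l)) (\<lambda>l. fst (dig t l)))"
  define py where "py = (\<lambda>t. radix_value (\<lambda>l. n (\<omega> l)) (\<lambda>l. snd (dig t l)))"
  define iu where "iu = (\<lambda>t. col_index (\<lambda>l. fst (dig t l)) h')"
  define iv where "iv = (\<lambda>t. row_index (\<lambda>l. snd (dig t l)) k')"
  have pF: "(px t, py t) \<in> F" if "t \<in> T" for t
    unfolding px_def py_def using digit_point_in_attractor digD[OF that] by blast
  have pcell: "px t \<in> col_cell (\<lambda>l. fst (dig t l)) l" "py t \<in> row_cell (\<lambda>l. snd (dig t l)) l" if "t \<in> T" for t l
    unfolding px_def py_def
    using col.radix_value_in_cell row.radix_value_in_cell digit_bounds[OF digD[OF that]] by auto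
  have close: "dist (px t, py t) (px t', py t') \<le> 2 / H k" if "t \<in> T" "t' \<in> T" for t t'
  proof -
    have "fst (dig t l) = fst (dig t' l)" if "l < h" for l
      using that lev by (auto simp: dig_def split: prod.split)
    then have "col_index (\<lambda>l. fst (dig t l)) h = col_index (\<lambda>l. fst (dig t' l)) h"
      by (rule cell_index_cong)
    then have "col_cell (\<lambda>l. fst (dig t l)) h = col_cell (\<lambda>l. fst (dig t' l)) h"
      by (simp add: radix_cell_def)
    then have "\<bar>px t - px t'\<bar> \<le> 1 / M h" using col.radix_cell_dist pcell(1) that by metis
    also have "\<dots> \<le> 1 / H k" using HM by (intro divide_left_mono) auto
    finally have x: "\<bar>px t - px t'\<bar> \<le> 1 / H k" .
    have "snd (dig t l) = snd (dig t' l)" if "l < k" for l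
      using that lev by (auto simp: dig_def split: prod.split)
    then have "row_index (\<lambda>l. snd (dig t l)) k = row_index (\<lambda>l. snd (dig t' l)) k"
      by (rule cell_index_cong)
    then have "row_cell (\<lambda>l. snd (dig t l)) k = row_cell (\<lambda>l. snd (dig t' l)) k"
      by (simp add: radix_cell_def)
    then have y: "\<bar>py t - py t'\<bar> \<le> 1 / H k" using row.radix_cell_dist pcell(2) that by metis
    have "dist (px t, py t) (px t', py t') \<le> \<bar>px t - px t'\<bar> + \<bar>py t - py t'\<bar>"
      using sqrt_sum_squares_le_sum_abs[of "px t - px t'" "py t - py t'"] by (simp add: dist_Pair_Pair dist_real_def)
    then show ?thesis using x y by simp
  qed
  have inj: "inj_on (\<lambda>t. (iu t, iv t)) T"
  proof (rule inj_onI, clarify)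
    fix a b a' b' assume t: "(a, b) \<in> T" "(a', b') \<in> T"
      and eq: "iu (a, b) = iu (a', b')" "iv (a, b) = iv (a', b')"
    have *: "fst (dig (a, b) l) = fst (dig (a', b') l)" if "l < h'" for l
      using cell_index_digits_eq[OF _ _ eq(1)[unfolded iu_def] that] digit_bounds digD t by blast
    have **: "snd (dig (a, b) l) = snd (dig (a', b') l)" if "l < k'" for l
      using cell_index_digits_eq[OF _ _ eq(2)[unfolded iv_def] that] digit_bounds digD t by blast
    have aa: "a l = a' l" if "l \<in> {h..<h'}" for l
      using *[of l] that lev by (auto simp: dig_def)
    have bb: "b l = b' l" if "l \<in> {k..<k'}" for l
      using **[of l] that lev by (auto simp: dig_def)
    show "a = a' \<and> b = b'"
    proof (intro conjI)
      have "a \<in> PiE {h..<h'} (\<lambda>l. fst ` D (\<omega> l))" "a' \<in> PiE {h..<h'} (\<lambda>l. fst ` D (\<omega> l))"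
        "b \<in> PiE {k..<k'} (\<lambda>l. {b. (a0 l, b) \<in> D (\<omega> l)})" "b' \<in> PiE {k..<k'} (\<lambda>l. {b. (a0 l, b) \<in> D (\<omega> l)})"
        using t unfolding T_def by blast+
      note PiE = this
      show "a = a'" by (rule PiE_ext[OF PiE(1,2)]) (rule aa)
      show "b = b'" by (rule PiE_ext[OF PiE(3,4)]) (rule bb)
    qed
  qed
  have cardT: "card T = (\<Prod>l\<in>{h..<h'}. num_columns (D (\<omega> l))) * (\<Prod>l\<in>{k..<k'}. max_in_column (m (\<omega> l)) (D (\<omega> l)))"
    by (simp add: T_def card_cartesian_product card_PiE num_columns_def ab(1))
  have "T \<noteq> {}" unfolding T_def using ab(2) by (force simp: PiE_eq_empty_iff)
  then obtain t0 where t0: "t0 \<in> T" by blast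
  let ?E = "cball (px t0, py t0) (2 / H k) \<inter> F"
  have "bounded ?E" by (rule bounded_subset[OF bounded_cball]) auto
  then obtain \<U> where U: "finite \<U>" "card \<U> = covering_number r ?E"
    "\<And>U. U \<in> \<U> \<Longrightarrow> bounded U \<and> diameter U \<le> r" "?E \<subseteq> \<Union>\<U>"
    using covering_number_attained r(1) by blast
  define J1 where "J1 = (\<lambda>U :: (real \<times> real) set. {u :: nat. \<exists>s\<in>fst ` U. real u / M h' \<le> s \<and> s \<le> (real u + 1) / M h'})"
  define J2 where "J2 = (\<lambda>U :: (real \<times> real) set. {u :: nat. \<exists>s\<in>snd ` U. real u / H k' \<le> s \<and> s \<le> (real u + 1) / H k'})"
  have J: "finite (J1 U \<times> J2 U)" "card (J1 U \<times> J2 U) \<le> 9" if "U \<in> \<U>" for U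
  proof -
    have d: "dist p q \<le> r" if "p \<in> U" "q \<in> U" for p q
      using diameter_bounded_bound[OF _ that] U(3)[OF \<open>U \<in> \<U>\<close>] by (meson order_trans)
    have "\<bar>s - t\<bar> \<le> r" if "s \<in> fst ` U" "t \<in> fst ` U" for s t
      using that d order_trans[OF dist_fst_le] by (force simp: dist_real_def)
    note 1 = col.card_cells_meeting[of "fst ` U" r h' 1, OF this]
    have "\<bar>s - t\<bar> \<le> r" if "s \<in> snd ` U" "t \<in> snd ` U" for s t
      using that d order_trans[OF dist_snd_le] by (force simp: dist_real_def)
    note 2 = row.card_cells_meeting[of "snd ` U" r k' 1, OF this]
    have J3: "finite (J1 U)" "card (J1 U) \<le> 3" "finite (J2 U)" "card (J2 U) \<le> 3"
      using 1 2 r unfolding J1_def J2_def by auto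
    then show "finite (J1 U \<times> J2 U)" by blast
    show "card (J1 U \<times> J2 U) \<le> 9"
      using mult_le_mono[OF J3(2,4)] by (simp add: card_cartesian_product)
  qed
  have "(\<lambda>t. (iu t, iv t)) ` T \<subseteq> (\<Union>U\<in>\<U>. J1 U \<times> J2 U)"
  proof clarify
    fix a b assume t: "(a, b) \<in> T"
    then have "(px (a, b), py (a, b)) \<in> ?E" using pF close[OF t0] by auto
    then obtain U where "U \<in> \<U>" "(px (a, b), py (a, b)) \<in> U" using U(4) by blast
    then have "iu (a, b) \<in> J1 U" "iv (a, b) \<in> J2 U"
      unfolding J1_def J2_def using pcell(1)[OF t, of h'] pcell(2)[OF t, of k']
      by (force simp: radix_cell_def iu_def iv_def)+
    with \<open>U \<in> \<U>\<close> show "(iu (a, b), iv (a, b)) \<in> (\<Union>U\<in>\<U>. J1 U \<times> J2 U)" by blast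
  qed
  then have "card ((\<lambda>t. (iu t, iv t)) ` T) \<le> card (\<Union>U\<in>\<U>. J1 U \<times> J2 U)"
    using U(1) J by (intro card_mono) auto
  also have "\<dots> \<le> (\<Sum>U\<in>\<U>. card (J1 U \<times> J2 U))" using U(1) by (rule card_UN_le)
  also have "\<dots> \<le> 9 * card \<U>"
    using sum_bounded_above[of \<U> "\<lambda>U. card (J1 U \<times> J2 U)" 9] J by (simp add: mult.commute)
  finally have "card T \<le> 9 * covering_number r ?E" by (simp add: card_image[OF inj] U(2))
  then show ?thesis using that[OF pF[OF t0]] cardT by simp
qed

end

section \<open>Blocks of letters under the Bernoulli measure\<close>

locale bernoulli_letters =
  fixes N :: nat and p :: "nat \<Rightarrow> real"
  assumes p_pos: "i \<in> {1..N} \<Longrightarrow> 0 < p i" and p_sum: "(\<Sum>i\<in>{1..N}. p i) = 1"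
begin

abbreviation \<mu> where "\<mu> \<equiv> bernoulli_measure N p"
abbreviation \<Omega> where "\<Omega> \<equiv> space (bernoulli_measure N p)"

sublocale prob_space \<mu>
  unfolding bernoulli_measure_def
proof (rule prob_space_PiM)
  have "(\<Sum>i\<in>{1..N}. ennreal (p i)) = ennreal (\<Sum>i\<in>{1..N}. p i)"
    using p_pos by (intro sum_ennreal) (auto simp: less_imp_le)
  then show "prob_space (point_measure {1..N} (\<lambda>i. ennreal (p i)))"
    using p_sum by (intro prob_space_point_measure) auto
qed

definition cylinder :: "nat \<Rightarrow> (nat \<Rightarrow> nat) \<Rightarrow> (nat \<Rightarrow> nat) set" where
  "cylinder k w = {\<omega> \<in> \<Omega>. \<forall>l<k. \<omega> l = w l}"

text \<open>
  Membership depends on the first \<open>k\<close> letters only. Requiring one implication suffices, since the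
  relation of having the same first \<open>k\<close> letters is symmetric.
\<close>
definition determined :: "nat \<Rightarrow> (nat \<Rightarrow> nat) set \<Rightarrow> bool" where
  "determined k E \<longleftrightarrow> E \<subseteq> \<Omega> \<and> (\<forall>\<omega>\<in>E. \<forall>\<omega>'\<in>\<Omega>. (\<forall>l<k. \<omega> l = \<omega>' l) \<longrightarrow> \<omega>' \<in> E)"

lemma letter: "\<omega> \<in> \<Omega> \<Longrightarrow> \<omega> l \<in> {1..N}"
  by (simp add: space_bernoulli_measure)

text \<open>
  By convention \<^const>\<open>emeasure\<close> vanishes outside the sigma-algebra, whereas its value at a cylinder is positive.
\<close>
lemma cylinder_sets: assumes "\<And>l. l < k \<Longrightarrow> w l \<in> {1..N}" shows "cylinder k w \<in> sets \<mu>"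
proof (rule ccontr)
  assume "cylinder k w \<notin> sets \<mu>"
  then have "emeasure \<mu> (cylinder k w) = 0" by (rule emeasure_notin_sets)
  moreover have "emeasure \<mu> (cylinder k w) = ennreal (\<Prod>l<k. p (w l))"
    unfolding cylinder_def using p_pos p_sum assms by (rule emeasure_bernoulli_measure_cylinder)
  moreover have "0 < (\<Prod>l<k. p (w l))" using assms p_pos by (intro prod_pos) auto
  ultimately show False by (metis ennreal_eq_0_iff not_less)
qed

lemma prob_cylinder:
  assumes "\<And>l. l < k \<Longrightarrow> w l \<in> {1..N}" shows "prob (cylinder k w) = (\<Prod>l<k. p (w l))"
proof -
  have "emeasure \<mu> (cylinder k w) = ennreal (\<Prod>l<k. p (w l))"
    unfolding cylinder_def using p_pos p_sum assms by (rule emeasure_bernoulli_measure_cylinder)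
  moreover have "0 < (\<Prod>l<k. p (w l))" using assms p_pos by (intro prod_pos) auto
  ultimately show ?thesis unfolding measure_def by (metis enn2real_ennreal less_imp_le)
qed

lemma determined_subset: "determined k E \<Longrightarrow> E \<subseteq> \<Omega>"
  unfolding determined_def by (rule conjunct1)

lemma determined_mono: "determined k E \<Longrightarrow> k \<le> k' \<Longrightarrow> determined k' E"
  unfolding determined_def by (meson less_le_trans)

lemma determined_Int: "determined k E \<Longrightarrow> determined k E' \<Longrightarrow> determined k (E \<inter> E')"
  unfolding determined_def by blast

lemma determinedD:
  "determined k E \<Longrightarrow> \<omega> \<in> E \<Longrightarrow> \<omega>' \<in> \<Omega> \<Longrightarrow> (\<And>l. l < k \<Longrightarrow> \<omega> l = \<omega>' l) \<Longrightarrow> \<omega>' \<in> E"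
  unfolding determined_def by simp

lemma determinedI:
  assumes "E \<subseteq> \<Omega>" "\<And>\<omega> \<omega>'. \<omega> \<in> E \<Longrightarrow> \<omega>' \<in> \<Omega> \<Longrightarrow> (\<And>l. l < k \<Longrightarrow> \<omega> l = \<omega>' l) \<Longrightarrow> \<omega>' \<in> E"
  shows "determined k E"
  using assms unfolding determined_def by simp

lemma determined_Diff:
  assumes "determined k E" "determined k E'" shows "determined k (E - E')"
proof (rule determinedI)
  show "E - E' \<subseteq> \<Omega>" using determined_subset[OF assms(1)] by blast
  fix \<omega> \<omega>' assume *: "\<omega> \<in> E - E'" "\<omega>' \<in> \<Omega>" "\<And>l. l < k \<Longrightarrow> \<omega> l = \<omega>' l"
  have "\<omega>' \<in> E" using determinedD[OF assms(1) _ *(2)] * by blast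
  moreover have "\<omega>' \<notin> E'"
  proof
    assume "\<omega>' \<in> E'"
    then have "\<omega> \<in> E'" using determinedD[OF assms(2), of \<omega>' \<omega>] * determined_subset[OF assms(1)] by force
    with * show False by blast
  qed
  ultimately show "\<omega>' \<in> E - E'" by blast
qed

lemma determined_letter: "l < k \<Longrightarrow> determined k {\<omega> \<in> \<Omega>. \<omega> l = v}"
  unfolding determined_def by auto

text \<open>
  A set determined by \<open>k\<close> letters is a finite disjoint union of cylinders of level \<open>k\<close>, and prescribing the next letter
  replaces each of these cylinders by one of its children.
\<close>
lemma
  assumes E: "determined k E"
  shows determined_sets: "E \<in> sets \<mu>"
    and prob_next_letter: "v \<in> {1..N} \<Longrightarrow> prob {\<omega> \<in> E. \<omega> k = v} = prob E * p v"
proof -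
  let ?W = "{w \<in> PiE {..<k} (\<lambda>_. {1..N}). cylinder k w \<subseteq> E}"
  have fin: "finite ?W" by (rule finite_subset[of _ "PiE {..<k} (\<lambda>_. {1..N})"]) (auto intro: finite_PiE)
  have W: "w l \<in> {1..N}" if "w \<in> ?W" "l < k" for w l using that by auto
  have disj: "w = w'" if "w \<in> ?W" "w' \<in> ?W" "\<omega> \<in> cylinder k w" "\<omega> \<in> cylinder k w'" for w w' \<omega>
  proof (rule PiE_ext[of w "{..<k}" "\<lambda>_. {1..N}"])
    show "w l = w' l" if "l \<in> {..<k}" for l
      using that \<open>\<omega> \<in> cylinder k w\<close> \<open>\<omega> \<in> cylinder k w'\<close> by (simp add: cylinder_def)
  qed (use that in auto)
  have ex: "\<exists>w\<in>?W. \<omega> \<in> cylinder k w" if w: "\<omega> \<in> E" for \<omega>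
  proof (rule bexI[of _ "restrict \<omega> {..<k}"])
    have \<Omega>: "\<omega> \<in> \<Omega>" using w determined_subset[OF E] by blast
    then show "\<omega> \<in> cylinder k (restrict \<omega> {..<k})" by (simp add: cylinder_def)
    have "cylinder k (restrict \<omega> {..<k}) \<subseteq> E"
      by (rule subsetI, rule determinedD[OF E w]) (auto simp: cylinder_def)
    then show "restrict \<omega> {..<k} \<in> ?W" using letter[OF \<Omega>] by auto
  qed
  have E_eq: "E = (\<Union>w\<in>?W. cylinder k w)" 
  proof
    show "E \<subseteq> (\<Union>w\<in>?W. cylinder k w)" using ex by (intro subsetI UN_iff[THEN iffD2])
  qed blast
  have sets: "cylinder k w \<in> sets \<mu>" if "w \<in> ?W" for w using cylinder_sets W[OF that] by blast
  show "E \<in> sets \<mu>" by (subst E_eq) (rule sets.finite_UN[OF fin sets])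
  have pE: "prob E = (\<Sum>w\<in>?W. prob (cylinder k w))"
    by (subst E_eq, rule finite_measure_finite_Union[OF fin])
      (use sets disj in \<open>auto simp: disjoint_family_on_def\<close>)
  assume v: "v \<in> {1..N}"
  have W': "(w(k := v)) l \<in> {1..N}" if "w \<in> ?W" "l < Suc k" for w l
    using v W[OF that(1), of l] that(2) by (auto simp: less_Suc_eq)
  have cyl: "cylinder (Suc k) (w(k := v)) = {\<omega> \<in> cylinder k w. \<omega> k = v}" for w
    by (auto simp: cylinder_def less_Suc_eq)
  have split: "{\<omega> \<in> E. \<omega> k = v} = (\<Union>w\<in>?W. cylinder (Suc k) (w(k := v)))"
    unfolding cyl by (subst (1) E_eq) blast
  have "prob {\<omega> \<in> E. \<omega> k = v} = (\<Sum>w\<in>?W. prob (cylinder (Suc k) (w(k := v))))"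
    unfolding split
  proof (rule finite_measure_finite_Union[OF fin])
    show "(\<lambda>w. cylinder (Suc k) (w(k := v))) ` ?W \<subseteq> sets \<mu>"
      by (intro image_subsetI cylinder_sets W')
    show "disjoint_family_on (\<lambda>w. cylinder (Suc k) (w(k := v))) ?W"
      unfolding cyl disjoint_family_on_def
    proof (intro ballI impI)
      fix w w' assume w: "w \<in> ?W" "w' \<in> ?W" "w \<noteq> w'"
      then have "cylinder k w \<inter> cylinder k w' = {}" using disj[OF w(1,2)] by blast
      then show "{\<omega> \<in> cylinder k w. \<omega> k = v} \<inter> {\<omega> \<in> cylinder k w'. \<omega> k = v} = {}" by blast
    qed
  qed
  also have "\<dots> = (\<Sum>w\<in>?W. prob (cylinder k w) * p v)"
  proof (rule sum.cong[OF refl])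
    fix w assume w: "w \<in> ?W"
    show "prob (cylinder (Suc k) (w(k := v))) = prob (cylinder k w) * p v"
      using prob_cylinder[of "Suc k" "w(k := v)", OF W'[OF w]] prob_cylinder[of k w, OF W[OF w]] by simp
  qed
  finally show "prob {\<omega> \<in> E. \<omega> k = v} = prob E * p v"
    by (simp add: pE sum_distrib_right)
qed

lemma
  assumes E: "determined k E" and v: "v \<in> {1..N}"
  shows determined_block: "determined (k + q) {\<omega> \<in> E. \<forall>l\<in>{k..<k + q}. \<omega> l = v}"
    and prob_block: "prob {\<omega> \<in> E. \<forall>l\<in>{k..<k + q}. \<omega> l = v} = prob E * p v ^ q"
proof (induction q)
  case 0
  { case 1 then show ?case using E by simp }
  { case 2 then show ?case by simp }
next
  case (Suc q)
  let ?B = "{\<omega> \<in> E. \<forall>l\<in>{k..<k + q}. \<omega> l = v}"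
  have eq: "{\<omega> \<in> E. \<forall>l\<in>{k..<k + Suc q}. \<omega> l = v} = {\<omega> \<in> ?B. \<omega> (k + q) = v}"
    by (auto simp: atLeastLessThanSuc)
  have "?B \<subseteq> \<Omega>" by (rule determined_subset[OF Suc(1)])
  then have eq2: "{\<omega> \<in> ?B. \<omega> (k + q) = v} = ?B \<inter> {\<omega> \<in> \<Omega>. \<omega> (k + q) = v}" by blast
  { case 1 show ?case unfolding eq eq2
      by (rule determined_Int[OF determined_mono[OF Suc(1)] determined_letter]) auto }
  { case 2 show ?case unfolding eq prob_next_letter[OF Suc(1) v] Suc(2) by simp }
qed

text \<open>
  Independence across a stopping time: the second block starts at the random position \<open>\<tau>\<close>, but on the event \<open>\<tau> = h\<close>
  everything before it is determined by \<open>h\<close> letters. Hence the second block multiplies the probability of each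
  of these finitely many pieces by the same factor.
\<close>
lemma
  fixes \<tau> :: "(nat \<Rightarrow> nat) \<Rightarrow> nat" and q' :: nat
  assumes E: "determined k E" and v: "j \<in> {1..N}" "i \<in> {1..N}"
    and \<tau>: "\<And>\<omega>. \<omega> \<in> \<Omega> \<Longrightarrow> k + q \<le> \<tau> \<omega> \<and> \<tau> \<omega> \<le> b"
    and stop: "\<And>h. determined h {\<omega> \<in> \<Omega>. \<tau> \<omega> = h}"
  defines "G \<equiv> {\<omega> \<in> E. (\<forall>l\<in>{k..<k + q}. \<omega> l = j) \<and> (\<forall>l\<in>{\<tau> \<omega>..<\<tau> \<omega> + q'}. \<omega> l = i)}"
  shows determined_two_blocks: "determined (b + q') G"
    and prob_two_blocks: "prob G = prob E * (p j ^ q * p i ^ q')"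
proof -
  let ?B = "{\<omega> \<in> E. \<forall>l\<in>{k..<k + q}. \<omega> l = j}"
  define X where "X = (\<lambda>h. ?B \<inter> {\<omega> \<in> \<Omega>. \<tau> \<omega> = h})"
  define Y where "Y = (\<lambda>h. {\<omega> \<in> X h. \<forall>l\<in>{h..<h + q'}. \<omega> l = i})"
  have E\<Omega>: "E \<subseteq> \<Omega>" by (rule determined_subset[OF E])
  have B: "determined (k + q) ?B" "prob ?B = prob E * p j ^ q"
    by (rule determined_block[OF E v(1)], rule prob_block[OF E v(1)])
  have X: "determined h (X h)" if "h \<in> {k + q..b}" for h
    unfolding X_def using that by (intro determined_Int determined_mono[OF B(1)] stop) auto
  have Y: "determined (h + q') (Y h)" "prob (Y h) = prob (X h) * p i ^ q'" if "h \<in> {k + q..b}" for h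
    unfolding Y_def by (rule determined_block[OF X[OF that] v(2)], rule prob_block[OF X[OF that] v(2)])
  have G_eq: "G = (\<Union>h\<in>{k + q..b}. Y h)" unfolding G_def Y_def X_def using \<tau> E\<Omega> by fastforce
  have B_eq: "?B = (\<Union>h\<in>{k + q..b}. X h)" unfolding X_def using \<tau> E\<Omega> by fastforce
  have Y': "determined (b + q') (Y h)" if "h \<in> {k + q..b}" for h
    using that by (intro determined_mono[OF Y(1)]) auto
  then show "determined (b + q') G" unfolding G_eq determined_def by blast
  have "prob G = (\<Sum>h\<in>{k + q..b}. prob (Y h))" unfolding G_eq
    by (rule finite_measure_finite_Union) (use determined_sets[OF Y(1)] in \<open>auto simp: disjoint_family_on_def Y_def X_def\<close>)
  also have "\<dots> = (\<Sum>h\<in>{k + q..b}. prob (X h)) * p i ^ q'"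
    using Y(2) by (simp add: sum_distrib_right)
  also have "(\<Sum>h\<in>{k + q..b}. prob (X h)) = prob ?B"
    by (subst B_eq, rule finite_measure_finite_Union[symmetric])
      (use determined_sets[OF X] in \<open>auto simp: disjoint_family_on_def X_def\<close>)
  finally show "prob G = prob E * (p j ^ q * p i ^ q')" using B(2) by simp
qed

text \<open>
  Positions \<open>ks t\<close> are chosen so sparsely that whether the two blocks occur at \<open>ks t\<close> is determined before
  \<open>ks (t + 1)\<close>. Each attempt then succeeds with the same conditional probability \<open>c > 0\<close>, so the first \<open>t\<close> attempts
  all fail with probability \<open>(1 - c) ^ t\<close>.
\<close>
lemma AE_two_blocks:
  assumes v: "j \<in> {1..N}" "i \<in> {1..N}"
    and \<tau>: "\<And>k \<omega>. K \<le> k \<Longrightarrow> \<omega> \<in> \<Omega> \<Longrightarrow> k + q \<le> \<tau> k \<omega> \<and> \<tau> k \<omega> \<le> b k"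
    and stop: "\<And>k h. K \<le> k \<Longrightarrow> determined h {\<omega> \<in> \<Omega>. \<tau> k \<omega> = h}"
  shows "AE \<omega> in \<mu>. \<exists>k\<ge>K. (\<forall>l\<in>{k..<k + q}. \<omega> l = j) \<and> (\<forall>l\<in>{\<tau> k \<omega>..<\<tau> k \<omega> + q'}. \<omega> l = i)"
proof -
  define good where "good = (\<lambda>k \<omega>. (\<forall>l\<in>{k..<k + q}. \<omega> l = j) \<and> (\<forall>l\<in>{\<tau> k \<omega>..<\<tau> k \<omega> + q'}. \<omega> l = i))"
  define c where "c = p j ^ q * p i ^ q'"
  define ks where "ks = rec_nat K (\<lambda>_ k. k + b k + q')"
  have ks: "ks 0 = K" "ks (Suc t) = ks t + b (ks t) + q'" for t by (simp_all add: ks_def)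
  have ks_ge: "K \<le> ks t" for t by (induction t) (auto simp: ks)
  define bad where "bad = (\<lambda>t. {\<omega> \<in> \<Omega>. \<forall>s<t. \<not> good (ks s) \<omega>})"
  have bad: "determined (ks t) (bad t) \<and> prob (bad t) = (1 - c) ^ t" for t
  proof (induction t)
    case 0
    have "bad 0 = \<Omega>" by (simp add: bad_def)
    then show ?case by (simp add: determined_def prob_space)
  next
    case (Suc t)
    let ?G = "{\<omega> \<in> bad t. good (ks t) \<omega>}"
    have G: "determined (b (ks t) + q') ?G" "prob ?G = prob (bad t) * c"
      unfolding good_def c_def
      by (rule determined_two_blocks[OF conjunct1[OF Suc] v \<tau>[OF ks_ge] stop[OF ks_ge]], assumption)
        (rule prob_two_blocks[OF conjunct1[OF Suc] v \<tau>[OF ks_ge] stop[OF ks_ge]], assumption)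
    have eq: "bad (Suc t) = bad t - ?G" by (auto simp: bad_def less_Suc_eq)
    have "determined (ks (Suc t)) (bad t)" "determined (ks (Suc t)) ?G"
      by (rule determined_mono[OF conjunct1[OF Suc]], simp add: ks, rule determined_mono[OF G(1)], simp add: ks)
    then have d: "determined (ks (Suc t)) (bad (Suc t))" unfolding eq by (rule determined_Diff)
    have "prob (bad (Suc t)) = prob (bad t) - prob ?G" unfolding eq
      by (rule finite_measure_Diff[OF determined_sets[OF conjunct1[OF Suc]] determined_sets[OF G(1)]]) blast
    then show ?case using d G(2) Suc by (simp add: algebra_simps)
  qed
  have c: "0 < c" "c \<le> 1"
  proof -
    show "0 < c" unfolding c_def using p_pos v by simp
    have "0 \<le> (1 - c) ^ 1" using conjunct2[OF bad[of 1]] measure_nonneg[of \<mu> "bad 1"] by (simp only:)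
    then show "c \<le> 1" by simp
  qed
  let ?Z = "\<Inter>t. bad t"
  have sets: "bad t \<in> sets \<mu>" for t using determined_sets[OF conjunct1[OF bad]] .
  then have Z: "?Z \<in> sets \<mu>" by auto
  have le: "prob ?Z \<le> (1 - c) ^ t" for t
  proof -
    have "prob ?Z \<le> prob (bad t)" by (rule finite_measure_mono[OF _ sets]) blast
    then show ?thesis using conjunct2[OF bad[of t]] by (simp only:)
  qed
  have "(\<lambda>t. (1 - c) ^ t) \<longlonglongrightarrow> 0" using c by (intro LIMSEQ_realpow_zero) auto
  then have "prob ?Z \<le> 0" using le by (intro LIMSEQ_le_const) blast+
  then have "prob ?Z = 0" using measure_nonneg[of \<mu> ?Z] by linarith
  then have "?Z \<in> null_sets \<mu>" using Z by (simp add: null_sets_def emeasure_eq_measure)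
  moreover have "{\<omega> \<in> \<Omega>. \<not> (\<exists>k\<ge>K. good k \<omega>)} \<subseteq> ?Z"
    using ks_ge by (auto simp: bad_def)
  ultimately show ?thesis unfolding good_def by (rule AE_I')
qed

end

section \<open>Matching columns and rows of the same scale\<close>

lemma radix_prod_constant_block:
  assumes "\<And>l. l \<in> {k..<k + q} \<Longrightarrow> c l = v"
  shows "radix_prod c (k + q) = radix_prod c k * real v ^ q"
  using assms by (induction q) auto

lemma radix_prod_cong: "(\<And>l. l < k \<Longrightarrow> c l = c' l) \<Longrightarrow> radix_prod c k = radix_prod c' k"
  unfolding radix_prod_def by (intro prod.cong) auto

text \<open>
  The level at which the width of a cylinder first drops to the height of a cylinder of level \<open>k\<close>. It is a stopping
  time for the letter sequence.
\<close>
definition width_level :: "(nat \<Rightarrow> nat) \<Rightarrow> (nat \<Rightarrow> nat) \<Rightarrow> nat \<Rightarrow> (nat \<Rightarrow> nat) \<Rightarrow> nat" where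
  "width_level m n k \<omega> = (LEAST h. radix_prod (\<lambda>l. n (\<omega> l)) k \<le> radix_prod (\<lambda>l. m (\<omega> l)) h)"

context bm_sequence
begin

lemma Q_pos: "0 < Q" using col.two_le[of 0] col.le_bound[of 0] by linarith

lemma num_columns_pos: "0 < num_columns (D (\<omega> l))"
  using finite_D D_nonempty by (simp add: num_columns_def card_gt_0_iff)

lemma max_in_column_pos: "0 < max_in_column (m (\<omega> l)) (D (\<omega> l))"
proof -
  obtain a b where "card {b. (a, b) \<in> D (\<omega> l)} = max_in_column (m (\<omega> l)) (D (\<omega> l))" "(a, b) \<in> D (\<omega> l)"
    using obtain_max_column by metis
  moreover from this have "0 < card {b. (a, b) \<in> D (\<omega> l)}"
    using finite_section[of a l] unfolding card_gt_0_iff by blast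
  ultimately show ?thesis by simp
qed

lemma H_le_M: "H k \<le> M (k * Q)"
proof -
  have "H k \<le> real Q ^ k" using row.radix_prod_add_le[of 0 k] by simp
  also have "\<dots> \<le> (2 ^ Q) ^ k" by (intro power_mono) (auto intro: less_imp_le of_nat_less_two_power)
  also have "\<dots> = 2 ^ (k * Q)" by (simp add: power_mult[symmetric] mult.commute)
  also have "\<dots> \<le> M (k * Q)" by (rule col.radix_prod_ge)
  finally show ?thesis .
qed

lemma width_level_ge: "H k \<le> M (width_level m n k \<omega>)"
  unfolding width_level_def by (rule LeastI[of "\<lambda>h. H k \<le> M h", OF H_le_M])

lemma width_level_upper: "width_level m n k \<omega> \<le> k * Q"
  unfolding width_level_def by (rule Least_le[of "\<lambda>h. H k \<le> M h", OF H_le_M])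

lemma width_level_lower: "k \<le> width_level m n k \<omega>"
proof -
  have "M k \<le> M (width_level m n k \<omega>)" using M_le_H[of k] width_level_ge[of k] by linarith
  then show ?thesis by (simp add: strict_mono_less_eq[OF col.radix_prod_strict_mono])
qed

lemma M_width_level_le: "M (width_level m n k \<omega>) \<le> real Q * H k"
proof (cases "width_level m n k \<omega>")
  case 0
  have "1 \<le> (2::real) ^ k" by simp
  also have "\<dots> \<le> H k" by (rule row.radix_prod_ge)
  finally have "1 * 1 \<le> real Q * H k" using Q_pos by (intro mult_mono) auto
  then show ?thesis by (simp add: 0)
next
  case (Suc h)
  then have "\<not> H k \<le> M h" using not_less_Least[of h "\<lambda>h. H k \<le> M h"] by (simp add: width_level_def)
  then have "M h * real (m (\<omega> h)) \<le> H k * real Q"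
    using col.le_bound[of h] by (intro mult_mono) (auto simp: less_imp_le)
  then show ?thesis by (simp add: Suc mult.commute)
qed

lemma M_growth_le_H: "(1 + 1 / real Q) ^ k * M k \<le> H k"
proof (induction k)
  case (Suc k)
  have "real (m (\<omega> k)) / real Q \<le> 1" using col.le_bound[of k] Q_pos by simp
  moreover have "real (m (\<omega> k)) + 1 \<le> real (n (\<omega> k))" using m_less_n[of k] by linarith
  ultimately have *: "(1 + 1 / real Q) * real (m (\<omega> k)) \<le> real (n (\<omega> k))" by (simp add: algebra_simps)
  have "((1 + 1 / real Q) ^ k * M k) * ((1 + 1 / real Q) * real (m (\<omega> k))) \<le> H k * real (n (\<omega> k))"
    using Suc * by (intro mult_mono) (auto simp: less_imp_le)
  then show ?case by (simp add: mult_ac)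
qed simp

text \<open>
  Since \<open>n\<close> exceeds \<open>m\<close> by at least one, the ratio \<open>H k / M k\<close> grows exponentially, whereas \<open>q\<close> more levels
  increase \<open>M\<close> by a bounded factor only.
\<close>
lemma width_level_gap:
  assumes "real Q ^ q < (1 + 1 / real Q) ^ k" shows "k + q \<le> width_level m n k \<omega>"
proof (rule ccontr)
  assume "\<not> ?thesis"
  then have "M (width_level m n k \<omega>) \<le> M (k + q)"
    by (simp add: strict_mono_less_eq[OF col.radix_prod_strict_mono])
  also have "\<dots> \<le> M k * real Q ^ q" using col.radix_prod_add_le[of k "k + q"] by simp
  also have "\<dots> < M k * (1 + 1 / real Q) ^ k" using assms by (intro mult_strict_left_mono) auto
  also have "\<dots> \<le> H k" using M_growth_le_H[of k] by (simp add: mult.commute)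
  also have "\<dots> \<le> M (width_level m n k \<omega>)" by (rule width_level_ge)
  finally show False by simp
qed

text \<open>
  With \<open>R = 2 / H k\<close> and \<open>R / r\<close> comparable to \<open>n j ^ q\<close>, a block of \<open>q\<close> letters \<open>j\<close> at the row levels following
  \<open>k\<close> provides \<open>(n j ^ q) powr \<beta>\<close> rows, and a block of letters \<open>i\<close> at the column levels following
  \<open>width_level m n k \<omega>\<close> provides at least \<open>(n j ^ q) powr \<alpha>\<close> columns. The length \<open>q' q\<close> of the second block is tuned so that it
  spans the same range of scales. Letting \<open>q\<close> grow rules out every exponent below \<open>\<alpha> + \<beta>\<close>; that the blocks
  occur beyond every \<open>K\<close> makes \<open>R\<close> as small as the threshold \<open>\<rho>\<close> demands.
\<close>
lemma admissible_exponent_ge: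
  assumes C: "0 < C" "0 < \<rho>"
    and cov: "\<And>r R z. 0 < r \<Longrightarrow> r < R \<Longrightarrow> R \<le> \<rho> \<Longrightarrow> z \<in> F \<Longrightarrow>
      real (covering_number r (cball z R \<inter> F)) \<le> C * (R / r) powr \<gamma>"
    and A: "real (num_columns (D i)) = real (m i) powr \<alpha>" and \<alpha>: "0 \<le> \<alpha>" and mi: "0 < m i"
    and B: "real (max_in_column (m j) (D j)) = real (n j) powr \<beta>" and nj: "2 \<le> n j"
    and q': "\<And>q. real (n j) ^ q \<le> real (m i) ^ q' q" "\<And>q. real (m i) ^ q' q \<le> real Q * real (n j) ^ q"
    and blocks: "\<And>q K. \<exists>k\<ge>K. k + q \<le> width_level m n k \<omega> \<and> (\<forall>l\<in>{k..<k + q}. \<omega> l = j) \<and>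
      (\<forall>l\<in>{width_level m n k \<omega>..<width_level m n k \<omega> + q' q}. \<omega> l = i)"
  shows "\<alpha> + \<beta> \<le> \<gamma>"
proof (rule ccontr)
  assume "\<not> \<alpha> + \<beta> \<le> \<gamma>"
  then have \<delta>: "0 < \<alpha> + \<beta> - \<gamma>" by simp
  have nj1: "1 < real (n j)" using nj by simp
  obtain q where q: "9 * C * (2 * real Q ^ 2) powr \<gamma> < (real (n j) powr (\<alpha> + \<beta> - \<gamma>)) ^ q"
    using real_arch_pow[of "real (n j) powr (\<alpha> + \<beta> - \<gamma>)"] nj1 \<delta> by auto
  obtain K where K: "2 / \<rho> < 2 ^ K" using real_arch_pow[of 2 "2 / \<rho>"] by auto
  obtain k where k: "K \<le> k" "k + q \<le> width_level m n k \<omega>" "\<forall>l\<in>{k..<k + q}. \<omega> l = j"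
      "\<forall>l\<in>{width_level m n k \<omega>..<width_level m n k \<omega> + q' q}. \<omega> l = i" using blocks[of K q] by blast
  define h where "h = width_level m n k \<omega>"
  define t where "t = real (n j) ^ q"
  have t: "1 \<le> t" using nj1 by (simp add: t_def)
  have Q1: "1 \<le> real Q ^ 2" using Q_pos by simp
  have Mh: "M (h + q' q) \<le> real Q ^ 2 * t * H k"
  proof -
    have "M (h + q' q) = M h * real (m i) ^ q' q"
      by (rule radix_prod_constant_block) (use k(4) h_def in auto)
    also have "\<dots> \<le> (real Q * H k) * (real Q * t)"
      using M_width_level_le[of k] q'(2)[of q] by (intro mult_mono) (auto simp: h_def t_def less_imp_le)
    finally show ?thesis by (simp add: power2_eq_square mult_ac)
  qed
  have Hk: "H (k + q) = H k * t"
    unfolding t_def by (rule radix_prod_constant_block) (use k(3) in auto)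
  define r where "r = 1 / (real Q ^ 2 * t * H k)"
  have Qt: "1 \<le> real Q ^ 2 * t" using mult_mono[OF Q1 t] by simp
  have pos: "0 < real Q ^ 2 * t * H k" using Qt by (intro mult_pos_pos[of "real Q ^ 2 * t"]) auto
  have r0: "0 < r" unfolding r_def using pos by simp
  have "X * (1 / X) = 1" if "0 < X" for X :: real using that by simp
  from this[OF pos] have unit: "(real Q ^ 2 * t * H k) * r = 1" unfolding r_def .
  have "1 * H k \<le> real Q ^ 2 * t * H k" using Qt by (intro mult_right_mono) (auto simp: less_imp_le)
  then have "r \<le> 1 / H k" unfolding r_def using pos by (intro divide_left_mono) auto
  also have "\<dots> < 2 / H k" by (simp add: divide_strict_right_mono)
  finally have rR: "r < 2 / H k" .
  have "2 ^ K \<le> (2::real) ^ k" using k(1) by (intro power_increasing) auto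
  then have "2 / \<rho> \<le> H k" using K row.radix_prod_ge[of k] by linarith
  then have R\<rho>: "2 / H k \<le> \<rho>" using C(2) by (simp add: field_simps)
  have "M (h + q' q) * r \<le> (real Q ^ 2 * t * H k) * r" using Mh r0 by (intro mult_right_mono) auto
  then have r1: "M (h + q' q) * r \<le> 1" unfolding unit .
  have "H (k + q) \<le> real Q ^ 2 * t * H k"
    unfolding Hk using Q1 t mult_right_mono[OF Q1, of "t * H k"] by (simp add: mult_ac less_imp_le)
  then have "H (k + q) * r \<le> (real Q ^ 2 * t * H k) * r" using r0 by (intro mult_right_mono) auto
  then have r2: "H (k + q) * r \<le> 1" unfolding unit .
  obtain z where z: "z \<in> F" "(\<Prod>l\<in>{h..<h + q' q}. num_columns (D (\<omega> l))) *
      (\<Prod>l\<in>{k..<k + q}. max_in_column (m (\<omega> l)) (D (\<omega> l))) \<le> 9 * covering_number r (cball z (2 / H k) \<inter> F)"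
    by (rule covering_number_attractor_ge[of k "k + q" h "h + q' q" r])
      (use k(2) width_level_ge[of k] r0 r1 r2 in \<open>simp_all add: h_def\<close>)
  have "(\<Prod>l\<in>{h..<h + q' q}. num_columns (D (\<omega> l))) = num_columns (D i) ^ q' q"
    using k(4) by (simp add: h_def)
  moreover have "(\<Prod>l\<in>{k..<k + q}. max_in_column (m (\<omega> l)) (D (\<omega> l))) = max_in_column (m j) (D j) ^ q"
    using k(3) by simp
  ultimately have "real (num_columns (D i) ^ q' q * max_in_column (m j) (D j) ^ q)
      \<le> real (9 * covering_number r (cball z (2 / H k) \<inter> F))" using z(2) by (simp only: of_nat_le_iff)
  also have "\<dots> \<le> 9 * (C * ((2 / H k) / r) powr \<gamma>)" using cov[OF r0 rR R\<rho> z(1)] by simp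
  also have "(2 / H k) / r = (2 * real Q ^ 2) * t" unfolding r_def by simp
  also have "real (num_columns (D i) ^ q' q * max_in_column (m j) (D j) ^ q)
      = (real (m i) ^ q' q) powr \<alpha> * t powr \<beta>"
    using mi nj1 by (simp add: A B t_def powr_realpow[symmetric] powr_powr mult.commute)
  finally have up: "(real (m i) ^ q' q) powr \<alpha> * t powr \<beta> \<le> 9 * C * (2 * real Q ^ 2) powr \<gamma> * t powr \<gamma>"
    using t by (simp add: powr_mult mult_ac)
  have "t powr \<alpha> * t powr \<beta> \<le> (real (m i) ^ q' q) powr \<alpha> * t powr \<beta>"
    using q'(1)[of q] \<alpha> t by (intro mult_right_mono powr_mono2) (auto simp: t_def)
  with up have "t powr (\<alpha> + \<beta>) \<le> 9 * C * (2 * real Q ^ 2) powr \<gamma> * t powr \<gamma>" by (simp add: powr_add)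
  then have "t powr (\<alpha> + \<beta> - \<gamma>) \<le> 9 * C * (2 * real Q ^ 2) powr \<gamma>"
    using t by (simp add: powr_diff field_simps)
  moreover have "t powr (\<alpha> + \<beta> - \<gamma>) = (real (n j) powr (\<alpha> + \<beta> - \<gamma>)) ^ q"
    using nj1 by (simp add: t_def powr_realpow[symmetric] powr_powr mult.commute)
  ultimately show False using q by linarith
qed

lemma assouad_dim_attractor:
  assumes A_le: "\<And>l. real (num_columns (D (\<omega> l))) \<le> real (m (\<omega> l)) powr \<alpha>"
    and B_le: "\<And>l. real (max_in_column (m (\<omega> l)) (D (\<omega> l))) \<le> real (n (\<omega> l)) powr \<beta>"
    and ab: "0 \<le> \<alpha>" "0 \<le> \<beta>"
    and A: "real (num_columns (D i)) = real (m i) powr \<alpha>" and mi: "0 < m i"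
    and B: "real (max_in_column (m j) (D j)) = real (n j) powr \<beta>" and nj: "2 \<le> n j"
    and q': "\<And>q. real (n j) ^ q \<le> real (m i) ^ q' q" "\<And>q. real (m i) ^ q' q \<le> real Q * real (n j) ^ q"
    and blocks: "\<And>q K. \<exists>k\<ge>K. k + q \<le> width_level m n k \<omega> \<and> (\<forall>l\<in>{k..<k + q}. \<omega> l = j) \<and>
      (\<forall>l\<in>{width_level m n k \<omega>..<width_level m n k \<omega> + q' q}. \<omega> l = i)"
  shows "assouad_dim F = \<alpha> + \<beta>"
  unfolding assouad_dim_def
proof (rule cInf_eq_minimum)
  let ?C = "16 * (2 * real Q ^ 2) powr (\<alpha> + \<beta>)"
  have C: "0 < ?C" using Q_pos by simp
  have "\<forall>r R. 0 < r \<and> r < R \<and> R \<le> 1 \<longrightarrow>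
      (\<forall>x\<in>F. real (covering_number r (cball x R \<inter> F)) \<le> ?C * (R / r) powr (\<alpha> + \<beta>))"
    using covering_number_attractor_le[OF A_le B_le ab] by blast
  then show "\<alpha> + \<beta> \<in> {\<alpha>. 0 \<le> \<alpha> \<and> (\<exists>C>0. \<exists>\<rho>>0. \<forall>r R. 0 < r \<and> r < R \<and> R \<le> \<rho> \<longrightarrow>
      (\<forall>x\<in>F. real (covering_number r (cball x R \<inter> F)) \<le> C * (R / r) powr \<alpha>))}"
    using C ab by (intro CollectI conjI exI[of _ ?C] exI[of _ "1::real"]) auto
next
  fix \<gamma>
  assume "\<gamma> \<in> {\<alpha>. 0 \<le> \<alpha> \<and> (\<exists>C>0. \<exists>\<rho>>0. \<forall>r R. 0 < r \<and> r < R \<and> R \<le> \<rho> \<longrightarrow>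
      (\<forall>x\<in>F. real (covering_number r (cball x R \<inter> F)) \<le> C * (R / r) powr \<alpha>))}"
  then obtain C \<rho> where C: "0 < C" "0 < \<rho>" and
    cov: "\<And>r R z. 0 < r \<Longrightarrow> r < R \<Longrightarrow> R \<le> \<rho> \<Longrightarrow> z \<in> F \<Longrightarrow>
      real (covering_number r (cball z R \<inter> F)) \<le> C * (R / r) powr \<gamma>" by blast
  show "\<alpha> + \<beta> \<le> \<gamma>" by (rule admissible_exponent_ge[OF C cov A ab(1) mi B nj q' blocks])
qed

end

lemma eq_powr_ln_ratio:
  fixes a b :: real
  assumes "0 < a" "1 < b" shows "a = b powr (ln a / ln b)"
  using assms by (simp add: powr_def)

text \<open>
  The singleton \<open>{(0, 0)}\<close> stands in for the selected rectangles, because \<^const>\<open>width_level\<close> depends only on the grid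
  sizes.
\<close>
lemma (in bernoulli_letters) AE_blocks:
  assumes m: "\<And>i. i \<in> {1..N} \<Longrightarrow> 2 \<le> m i" "\<And>i. i \<in> {1..N} \<Longrightarrow> m i < n i" "\<And>i. i \<in> {1..N} \<Longrightarrow> n i \<le> Q"
    and ij: "i \<in> {1..N}" "j \<in> {1..N}"
  shows "AE \<omega> in \<mu>. \<forall>q K. \<exists>k\<ge>K. k + q \<le> width_level m n k \<omega> \<and> (\<forall>l\<in>{k..<k + q}. \<omega> l = j) \<and>
      (\<forall>l\<in>{width_level m n k \<omega>..<width_level m n k \<omega> + q' q}. \<omega> l = i)"
proof (simp only: AE_all_countable, intro allI)
  fix q K :: nat
  have seq: "bm_sequence m n (\<lambda>i. {(0, 0)}) \<omega> Q" if "\<omega> \<in> \<Omega>" for \<omega>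
  proof unfold_locales
    fix l
    note m_l = m[OF letter[OF that, of l]]
    show "2 \<le> m (\<omega> l)" "m (\<omega> l) < n (\<omega> l)" "n (\<omega> l) \<le> Q" by (rule m_l)+
    show "{(0, 0)} \<subseteq> {0..<m (\<omega> l)} \<times> {0..<n (\<omega> l)}" using m_l by auto
  qed simp
  have Q: "0 < Q" using m[OF ij(1)] by linarith
  then have "1 < 1 + 1 / real Q" by simp
  then obtain k1 where k1: "real Q ^ q < (1 + 1 / real Q) ^ k1" using real_arch_pow by blast
  have gap: "k + q \<le> width_level m n k \<omega>" if "k1 \<le> k" "\<omega> \<in> \<Omega>" for k \<omega>
  proof -
    interpret bm_sequence m n "\<lambda>i. {(0, 0)}" \<omega> Q by (rule seq[OF that(2)])
    have "(1 + 1 / real Q) ^ k1 \<le> (1 + 1 / real Q) ^ k" using that by (intro power_increasing) auto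
    then show ?thesis using k1 by (intro width_level_gap) linarith
  qed
  have upper: "width_level m n k \<omega> \<le> k * Q" if "\<omega> \<in> \<Omega>" for k \<omega>
    by (rule bm_sequence.width_level_upper[OF seq[OF that]])
  have stop: "determined h {\<omega> \<in> \<Omega>. width_level m n k \<omega> = h}" for k h
  proof (rule determinedI)
    fix \<omega> \<omega>' assume *: "\<omega> \<in> {\<omega> \<in> \<Omega>. width_level m n k \<omega> = h}" "\<omega>' \<in> \<Omega>" "\<And>l. l < h \<Longrightarrow> \<omega> l = \<omega>' l"
    then have \<omega>: "\<omega> \<in> \<Omega>" and wl: "width_level m n k \<omega> = h" by auto
    have kh: "k \<le> h" using bm_sequence.width_level_lower[OF seq[OF \<omega>], of k] wl by simp
    have n_eq: "radix_prod (\<lambda>l. n (\<omega>' l)) k = radix_prod (\<lambda>l. n (\<omega> l)) k"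
      using kh *(3) by (intro radix_prod_cong) simp
    have m_eq: "radix_prod (\<lambda>l. m (\<omega>' l)) y = radix_prod (\<lambda>l. m (\<omega> l)) y" if "y \<le> h" for y
      using that *(3) by (intro radix_prod_cong) simp
    have "width_level m n k \<omega>' = h"
      unfolding width_level_def n_eq
    proof (rule Least_equality)
      show "radix_prod (\<lambda>l. n (\<omega> l)) k \<le> radix_prod (\<lambda>l. m (\<omega>' l)) h"
        using bm_sequence.width_level_ge[OF seq[OF \<omega>], of k] wl m_eq[of h] by simp
      fix y assume y: "radix_prod (\<lambda>l. n (\<omega> l)) k \<le> radix_prod (\<lambda>l. m (\<omega>' l)) y"
      show "h \<le> y"
      proof (rule ccontr)
        assume "\<not> h \<le> y"
        then have "radix_prod (\<lambda>l. n (\<omega> l)) k \<le> radix_prod (\<lambda>l. m (\<omega> l)) y" using y m_eq[of y] by simp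
        then have "width_level m n k \<omega> \<le> y" unfolding width_level_def by (rule Least_le)
        then show False using wl \<open>\<not> h \<le> y\<close> by simp
      qed
    qed
    then show "\<omega>' \<in> {\<omega> \<in> \<Omega>. width_level m n k \<omega> = h}" using *(2) by simp
  qed auto
  have "AE \<omega> in \<mu>. \<exists>k\<ge>max K k1. (\<forall>l\<in>{k..<k + q}. \<omega> l = j) \<and>
      (\<forall>l\<in>{width_level m n k \<omega>..<width_level m n k \<omega> + q' q}. \<omega> l = i)"
    by (rule AE_two_blocks[OF ij(2,1), where K = "max K k1" and q = q and \<tau> = "width_level m n" and b = "\<lambda>k. k * Q" and q' = "q' q"])
      (use gap upper stop in auto)
  then show "AE \<omega> in \<mu>. \<exists>k\<ge>K. k + q \<le> width_level m n k \<omega> \<and> (\<forall>l\<in>{k..<k + q}. \<omega> l = j) \<and>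
      (\<forall>l\<in>{width_level m n k \<omega>..<width_level m n k \<omega> + q' q}. \<omega> l = i)"
    by (rule AE_mp, intro AE_I2) (use gap in \<open>auto intro: exI\<close>)
qed

theorem theorem3p2:
  fixes N :: nat
    and m n :: "nat \<Rightarrow> nat"
    and D :: "nat \<Rightarrow> (nat \<times> nat) set"
    and p :: "nat \<Rightarrow> real"
  assumes "\<And>i. i \<in> {1..N} \<Longrightarrow> 2 \<le> m i"
    and "\<And>i. i \<in> {1..N} \<Longrightarrow> m i < n i"
    and "\<And>i. i \<in> {1..N} \<Longrightarrow> D i \<subseteq> {0..<m i} \<times> {0..<n i}"
    and "\<And>i. i \<in> {1..N} \<Longrightarrow> D i \<noteq> {}"
    and "\<And>i. i \<in> {1..N} \<Longrightarrow> 0 < p i"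
    and "(\<Sum>i\<in>{1..N}. p i) = 1"
  shows "AE \<omega> in bernoulli_measure N p.
           assouad_dim (bm_attractor m n D \<omega>) =
             (MAX i\<in>{1..N}. ln (real (num_columns (D i))) / ln (real (m i))) +
             (MAX i\<in>{1..N}. ln (real (max_in_column (m i) (D i))) / ln (real (n i)))"
proof -
  interpret bernoulli_letters N p using assms(5,6) by unfold_locales
  have ne: "{1..N} \<noteq> {}"
  proof
    assume "{1..N} = {}"
    then have "(\<Sum>i\<in>{1..N}. p i) = 0" by (simp only: sum.empty)
    then show False using assms(6) by simp
  qed
  define Q where "Q = Max (n ` {1..N})"
  have nQ: "n i \<le> Q" if "i \<in> {1..N}" for i unfolding Q_def using that by (intro Max_ge) auto
  have seq: "bm_sequence m n D \<omega> Q" if "\<And>l. \<omega> l \<in> {1..N}" for \<omega>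
    by unfold_locales (use assms(1-4) nQ that in blast)+
  let ?a = "\<lambda>i. ln (real (num_columns (D i))) / ln (real (m i))"
  let ?b = "\<lambda>i. ln (real (max_in_column (m i) (D i))) / ln (real (n i))"
  let ?\<alpha> = "MAX i\<in>{1..N}. ?a i" and ?\<beta> = "MAX i\<in>{1..N}. ?b i"
  have A1: "1 \<le> real (num_columns (D i))" and B1: "1 \<le> real (max_in_column (m i) (D i))"
    and m1: "1 < real (m i)" and n1: "1 < real (n i)" if "i \<in> {1..N}" for i
    using bm_sequence.num_columns_pos[OF seq[of "\<lambda>_. i"]] bm_sequence.max_in_column_pos[OF seq[of "\<lambda>_. i"]]
      assms(1,2)[OF that] that by (auto simp: Suc_le_eq)
  have Aeq: "real (num_columns (D i)) = real (m i) powr ?a i"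
    and Beq: "real (max_in_column (m i) (D i)) = real (n i) powr ?b i" if "i \<in> {1..N}" for i
    using A1[OF that] B1[OF that] m1[OF that] n1[OF that] by (intro eq_powr_ln_ratio; linarith)+
  have a_le: "?a i \<le> ?\<alpha>" and b_le: "?b i \<le> ?\<beta>" if "i \<in> {1..N}" for i
    using that by (intro Max_ge; simp)+
  have A_le: "real (num_columns (D i)) \<le> real (m i) powr ?\<alpha>"
    and B_le: "real (max_in_column (m i) (D i)) \<le> real (n i) powr ?\<beta>" if i: "i \<in> {1..N}" for i
  proof -
    have "real (m i) powr ?a i \<le> real (m i) powr ?\<alpha>" using a_le[OF i] m1[OF i] by (intro powr_mono) auto
    then show "real (num_columns (D i)) \<le> real (m i) powr ?\<alpha>" using Aeq[OF i] by linarith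
    have "real (n i) powr ?b i \<le> real (n i) powr ?\<beta>" using b_le[OF i] n1[OF i] by (intro powr_mono) auto
    then show "real (max_in_column (m i) (D i)) \<le> real (n i) powr ?\<beta>" using Beq[OF i] by linarith
  qed
  have "?\<alpha> \<in> ?a ` {1..N}" "?\<beta> \<in> ?b ` {1..N}" using ne by (intro Max_in; simp)+
  then obtain i j where i: "i \<in> {1..N}" "?\<alpha> = ?a i" and j: "j \<in> {1..N}" "?\<beta> = ?b j" by blast
  have ab: "0 \<le> ?\<alpha>" "0 \<le> ?\<beta>"
    using A1[OF i(1)] m1[OF i(1)] B1[OF j(1)] n1[OF j(1)] by (simp_all only: i(2) j(2)) simp_all
  interpret mi: bounded_radix "\<lambda>_. m i" Q
    using assms(1,2)[OF i(1)] nQ[OF i(1)] by unfold_locales auto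
  \<comment> \<open>\<open>m i ^ q'\<close> is the first power of \<open>m i\<close> that exceeds \<open>n j ^ q\<close>.\<close>
  have "\<exists>q'. real (n j) ^ q \<le> real (m i) ^ q' \<and> real (m i) ^ q' \<le> real Q * real (n j) ^ q" for q
  proof -
    have "1 \<le> real (n j) ^ q" using n1[OF j(1)] by simp
    then obtain k where "radix_prod (\<lambda>_. m i) k \<le> real (n j) ^ q" "real (n j) ^ q < radix_prod (\<lambda>_. m i) (Suc k)"
      by (rule mi.radix_prod_bracket)
    then have k: "real (m i) ^ k \<le> real (n j) ^ q" "real (n j) ^ q < real (m i) ^ Suc k"
      by (simp_all add: radix_prod_def)
    have "real (m i) * real (m i) ^ k \<le> real Q * real (n j) ^ q"
      using k(1) mi.le_bound by (intro mult_mono) auto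
    with k(2) show ?thesis by (intro exI[of _ "Suc k"]) simp
  qed
  then obtain q' where q': "\<And>q. real (n j) ^ q \<le> real (m i) ^ q' q"
    "\<And>q. real (m i) ^ q' q \<le> real Q * real (n j) ^ q" by metis
  have "AE \<omega> in \<mu>. \<forall>q K. \<exists>k\<ge>K. k + q \<le> width_level m n k \<omega> \<and> (\<forall>l\<in>{k..<k + q}. \<omega> l = j) \<and>
      (\<forall>l\<in>{width_level m n k \<omega>..<width_level m n k \<omega> + q' q}. \<omega> l = i)"
    by (rule AE_blocks[OF assms(1,2) nQ i(1) j(1)])
  then show ?thesis
  proof (rule AE_mp, intro AE_I2 impI)
    fix \<omega> assume \<omega>: "\<omega> \<in> \<Omega>" and blocks: "\<forall>q K. \<exists>k\<ge>K. k + q \<le> width_level m n k \<omega> \<and>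
      (\<forall>l\<in>{k..<k + q}. \<omega> l = j) \<and> (\<forall>l\<in>{width_level m n k \<omega>..<width_level m n k \<omega> + q' q}. \<omega> l = i)"
    have "0 < m i" "2 \<le> n j" using m1[OF i(1)] n1[OF j(1)] by auto
    with Aeq[OF i(1), folded i(2)] Beq[OF j(1), folded j(2)] blocks
    show "assouad_dim (bm_attractor m n D \<omega>) = ?\<alpha> + ?\<beta>"
      by (intro bm_sequence.assouad_dim_attractor[OF seq[OF letter[OF \<omega>]]
          A_le[OF letter[OF \<omega>]] B_le[OF letter[OF \<omega>]] ab _ _ _ _ q']) blast+
  qed
qed

end
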